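(* Let $p$ be a prime, $\ell\ge1$, let $R(Z)\in\mathbb F_p[Z]$ be a polynomial with $\deg R<\ell$, and let $m\in[-\ell,\ell]$ be an integer. Suppose that there exist monic coprime polynomials $F(Z),G(Z)\in\mathbb F_p[Z]$ satisfying $$G(0)\ne0,\qquad \deg F+\deg G\le\ell,\qquad \deg F-\deg G=m,\qquad \frac{F(Z)}{G(Z)}\bmod Z^\ell=R(Z).$$ Then $F$ and $G$ are uniquely determined by $(R,m)$. Moreover, there is an algorithm (D-RFR) that recovers $F$ and $G$ from $(R,m)$ in $O(\ell\log^2\ell)$ field operations.
   Context: For $F,G\in\mathbb F_p[Z]$ with $G(0)\neq0$, $\frac{F(Z)}{G(Z)}\bmod Z^\ell$ denotes the unique polynomial $R$ with $\deg R<\ell$ and $R(Z)G(Z)\equiv F(Z)\pmod{Z^\ell}$. Cost is counted in operations in $\mathbb F_p$, using standard fast polynomial arithmetic (polynomials of degree at most $n$ are multiplied in $O(n\log n)$ field operations). *)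

theory Defs
  imports
    "HOL-Number_Theory.Residues"
    "HOL-Algebra.Polynomial_Divisibility"
    "HOL-Library.Landau_Symbols"
begin

section \<open>Rational function reconstruction\<close>

text \<open>
  The library's univariate polynomials over a ring \<open>K\<close> are coefficient lists, leading coefficient
  first and nonzero; the zero polynomial is \<open>[]\<close>, and its \<open>degree\<close> is \<open>0\<close>.
\<close>

abbreviation prime_field :: "nat \<Rightarrow> int ring" where
  "prime_field p \<equiv> residue_ring (int p)"

definition frac_mod :: "('a, 'b) ring_scheme \<Rightarrow> 'a list \<Rightarrow> 'a list \<Rightarrow> nat \<Rightarrow> 'a list" where
  "frac_mod K F G l =
     (THE R. R \<in> carrier (poly_ring K) \<and> degree R < l \<and>
        X\<^bsub>K\<^esub> [^]\<^bsub>poly_ring K\<^esub> l pdivides\<^bsub>K\<^esub> (R \<otimes>\<^bsub>poly_ring K\<^esub> G \<ominus>\<^bsub>poly_ring K\<^esub> F))"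

definition monic_poly :: "('a, 'b) ring_scheme \<Rightarrow> 'a list \<Rightarrow> bool" where
  "monic_poly K F \<longleftrightarrow> F \<in> carrier (poly_ring K) \<and> F \<noteq> [] \<and> lead_coeff F = \<one>\<^bsub>K\<^esub>"

definition rfr_instance :: "nat \<Rightarrow> nat \<Rightarrow> int list \<Rightarrow> int \<Rightarrow> bool" where
  "rfr_instance p l R m \<longleftrightarrow>
     Factorial_Ring.prime p \<and> 1 \<le> l \<and> R \<in> carrier (poly_ring (prime_field p)) \<and> degree R < l \<and>
     - int l \<le> m \<and> m \<le> int l"

definition rfr_solution :: "nat \<Rightarrow> nat \<Rightarrow> int list \<Rightarrow> int \<Rightarrow> int list \<Rightarrow> int list \<Rightarrow> bool" where
  "rfr_solution p l R m F G \<longleftrightarrow>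
     (let K = prime_field p in
        monic_poly K F \<and> monic_poly K G \<and>
        \<one>\<^bsub>poly_ring K\<^esub> gcdof\<^bsub>poly_ring K\<^esub> F G \<and>
        ring.eval K G \<zero>\<^bsub>K\<^esub> \<noteq> \<zero>\<^bsub>K\<^esub> \<and>
        degree F + degree G \<le> l \<and>
        int (degree F) - int (degree G) = m \<and>
        frac_mod K F G l = R)"


section \<open>Algorithms over a field and their number of field operations\<close>

text \<open>
  A program is a finite list of bodies of one-argument, mutually recursive first-order functions;
  execution starts in function \<open>0\<close>. The text of a program does not mention the field: field
  elements are opaque values that can be combined by field arithmetic, obtained as constants (the
  images of integers) and tested for zero, but not converted to integers. Each arithmetic operation
  and each zero test on field elements costs one. Control flow, list manipulation and integer
  arithmetic (indices and degrees) are free, as are the field constants.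

  Variables are de Bruijn indices into the list of values in scope.
\<close>

datatype 'a val = VInt int | VFld 'a | VNil | VPair "'a val" "'a val"

datatype int_op = IAdd | ISub | IMul | IDiv

datatype fld_op = FAdd | FSub | FMul | FDiv

datatype tm =
    Var nat
  | IntC int
  | IntOp int_op tm tm
  | FldC tm
  | FldOp fld_op tm tm
  | Nil
  | Pair tm tm
  | LetIn tm tm
  | IfPos tm tm tm
  | IfZero tm tm tm
  | CaseList tm tm tm
  | Call nat tm

type_synonym prog = "tm list"

fun int_op_sem :: "int_op \<Rightarrow> int \<Rightarrow> int \<Rightarrow> int" where
  "int_op_sem IAdd i j = i + j"
| "int_op_sem ISub i j = i - j"
| "int_op_sem IMul i j = i * j"
| "int_op_sem IDiv i j = i div j"

fun fld_op_sem :: "('a, 'b) ring_scheme \<Rightarrow> fld_op \<Rightarrow> 'a \<Rightarrow> 'a \<Rightarrow> 'a" where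
  "fld_op_sem K FAdd x y = x \<oplus>\<^bsub>K\<^esub> y"
| "fld_op_sem K FSub x y = x \<ominus>\<^bsub>K\<^esub> y"
| "fld_op_sem K FMul x y = x \<otimes>\<^bsub>K\<^esub> y"
| "fld_op_sem K FDiv x y = x \<otimes>\<^bsub>K\<^esub> inv\<^bsub>K\<^esub> y"

text \<open>
  \<open>exec K P \<rho> t v c\<close>: over the field \<open>K\<close>, with the values \<open>\<rho>\<close> in scope, the term \<open>t\<close> of the program
  \<open>P\<close> terminates with value \<open>v\<close> after exactly \<open>c\<close> field operations. Ill-typed terms, division by the
  zero of \<open>K\<close> and nontermination have no derivation.
\<close>

inductive exec ::
  "('a, 'b) ring_scheme \<Rightarrow> prog \<Rightarrow> 'a val list \<Rightarrow> tm \<Rightarrow> 'a val \<Rightarrow> nat \<Rightarrow> bool"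
  for K :: "('a, 'b) ring_scheme" and P :: prog
where
  Var: "i < length \<rho> \<Longrightarrow> exec K P \<rho> (Var i) (\<rho> ! i) 0"
| IntC: "exec K P \<rho> (IntC k) (VInt k) 0"
| IntOp: "\<lbrakk> exec K P \<rho> s (VInt i) c; exec K P \<rho> t (VInt j) d \<rbrakk>
    \<Longrightarrow> exec K P \<rho> (IntOp f s t) (VInt (int_op_sem f i j)) (c + d)"
| FldC: "exec K P \<rho> t (VInt k) c \<Longrightarrow> exec K P \<rho> (FldC t) (VFld ([k] \<cdot>\<^bsub>K\<^esub> \<one>\<^bsub>K\<^esub>)) c"
| FldOp: "\<lbrakk> exec K P \<rho> s (VFld x) c; exec K P \<rho> t (VFld y) d; f = FDiv \<longrightarrow> y \<noteq> \<zero>\<^bsub>K\<^esub> \<rbrakk>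
    \<Longrightarrow> exec K P \<rho> (FldOp f s t) (VFld (fld_op_sem K f x y)) (c + d + 1)"
| Nil: "exec K P \<rho> Nil VNil 0"
| Pair: "\<lbrakk> exec K P \<rho> s u c; exec K P \<rho> t v d \<rbrakk>
    \<Longrightarrow> exec K P \<rho> (Pair s t) (VPair u v) (c + d)"
| LetIn: "\<lbrakk> exec K P \<rho> s u c; exec K P (u # \<rho>) t v d \<rbrakk>
    \<Longrightarrow> exec K P \<rho> (LetIn s t) v (c + d)"
| IfPos: "\<lbrakk> exec K P \<rho> r (VInt i) c; exec K P \<rho> (if 0 < i then s else t) v d \<rbrakk>
    \<Longrightarrow> exec K P \<rho> (IfPos r s t) v (c + d)"
| IfZero: "\<lbrakk> exec K P \<rho> r (VFld x) c; exec K P \<rho> (if x = \<zero>\<^bsub>K\<^esub> then s else t) v d \<rbrakk>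
    \<Longrightarrow> exec K P \<rho> (IfZero r s t) v (c + 1 + d)"
| CaseNil: "\<lbrakk> exec K P \<rho> r VNil c; exec K P \<rho> s v d \<rbrakk>
    \<Longrightarrow> exec K P \<rho> (CaseList r s t) v (c + d)"
| CasePair: "\<lbrakk> exec K P \<rho> r (VPair a b) c; exec K P (a # b # \<rho>) t v d \<rbrakk>
    \<Longrightarrow> exec K P \<rho> (CaseList r s t) v (c + d)"
| Call: "\<lbrakk> exec K P \<rho> t u c; f < length P; exec K P [u] (P ! f) v d \<rbrakk>
    \<Longrightarrow> exec K P \<rho> (Call f t) v (c + d)"

inductive_cases exec_elims:
  "exec K P \<rho> (Var i) v c"
  "exec K P \<rho> (IntC k) v c"
  "exec K P \<rho> (IntOp f s t) v c"
  "exec K P \<rho> (FldC t) v c"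
  "exec K P \<rho> (FldOp g s t) v c"
  "exec K P \<rho> Nil v c"
  "exec K P \<rho> (Pair s t) v c"
  "exec K P \<rho> (LetIn s t) v c"
  "exec K P \<rho> (IfPos r s t) v c"
  "exec K P \<rho> (IfZero r s t) v c"
  "exec K P \<rho> (CaseList r s t) v c"
  "exec K P \<rho> (Call f t) v c"

lemma exec_deterministic:
  assumes "exec K P \<rho> t v c" and "exec K P \<rho> t v' c'"
  shows "v' = v \<and> c' = c"
  using assms
proof (induction arbitrary: v' c' rule: exec.induct)
  case (Var i \<rho>)
  from Var.prems show ?case by (rule exec_elims) simp
next
  case (IntC \<rho> k)
  from IntC.prems show ?case by (rule exec_elims) simp
next
  case (IntOp \<rho> s i c t j d f)
  from IntOp.prems show ?case
    by (rule exec_elims)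
      (drule IntOp.IH(1), clarsimp split del: if_split, drule IntOp.IH(2), clarsimp split del: if_split)
next
  case (FldC \<rho> t k c)
  from FldC.prems show ?case by (rule exec_elims) (drule FldC.IH, simp)
next
  case (FldOp \<rho> s x c t y d f)
  from FldOp.prems show ?case
    by (rule exec_elims)
      (drule FldOp.IH(1), clarsimp split del: if_split, drule FldOp.IH(2), clarsimp split del: if_split)
next
  case (Nil \<rho>)
  from Nil.prems show ?case by (rule exec_elims) simp
next
  case (Pair \<rho> s u c t v d)
  from Pair.prems show ?case
    by (rule exec_elims)
      (drule Pair.IH(1), clarsimp split del: if_split, drule Pair.IH(2), clarsimp split del: if_split)
next
  case (LetIn \<rho> s u c t v d)
  from LetIn.prems show ?case
    by (rule exec_elims)
      (drule LetIn.IH(1), clarsimp split del: if_split, drule LetIn.IH(2), clarsimp split del: if_split)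
next
  case (IfPos \<rho> r i c s t v d)
  from IfPos.prems show ?case
    by (rule exec_elims)
      (drule IfPos.IH(1), clarsimp split del: if_split, drule IfPos.IH(2), clarsimp split del: if_split)
next
  case (IfZero \<rho> r x c s t v d)
  from IfZero.prems show ?case
    by (rule exec_elims)
      (drule IfZero.IH(1), clarsimp split del: if_split, drule IfZero.IH(2), clarsimp split del: if_split)
next
  case (CaseNil \<rho> r c s v d t)
  from CaseNil.prems show ?case
    by (rule exec_elims) (auto dest: CaseNil.IH)
next
  case (CasePair \<rho> r a b c t v d s)
  from CasePair.prems show ?case
    by (rule exec_elims) (auto dest!: CasePair.IH(1) dest: CasePair.IH(2))
next
  case (Call \<rho> t u c f v d)
  from Call.prems show ?case
    by (rule exec_elims)
      (drule Call.IH(1), clarsimp split del: if_split, drule Call.IH(2), clarsimp split del: if_split)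
qed

definition run :: "('a, 'b) ring_scheme \<Rightarrow> prog \<Rightarrow> 'a val \<Rightarrow> 'a val \<Rightarrow> nat \<Rightarrow> bool" where
  "run K P u v c \<longleftrightarrow> exec K P [u] (Call 0 (Var 0)) v c"

fun poly_val :: "'a list \<Rightarrow> 'a val" where
  "poly_val [] = VNil"
| "poly_val (a # as) = VPair (VFld a) (poly_val as)"

text \<open>
  In both of the following definitions the program also receives the characteristic \<open>p\<close>, and the
  bound on the number of field operations does not depend on \<open>p\<close>.
\<close>

definition multiplies_within :: "nat \<Rightarrow> prog \<Rightarrow> (nat \<Rightarrow> nat) \<Rightarrow> bool" where
  "multiplies_within p M T \<longleftrightarrow>
     (let K = prime_field p in
        \<forall>n. \<forall>A \<in> carrier (poly_ring K). \<forall>B \<in> carrier (poly_ring K).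
          degree A \<le> n \<and> degree B \<le> n \<longrightarrow>
          (\<exists>c \<le> T n. run K M (VPair (VInt (int p)) (VPair (poly_val A) (poly_val B)))
                        (poly_val (A \<otimes>\<^bsub>poly_ring K\<^esub> B)) c))"

definition reconstructs_within :: "nat \<Rightarrow> prog \<Rightarrow> (nat \<Rightarrow> nat) \<Rightarrow> bool" where
  "reconstructs_within p D T \<longleftrightarrow>
     (\<forall>l R m F G. rfr_instance p l R m \<and> rfr_solution p l R m F G \<longrightarrow>
        (\<exists>c \<le> T l. run (prime_field p) D
                      (VPair (VInt (int p)) (VPair (VInt (int l)) (VPair (VInt m) (poly_val R))))
                      (VPair (poly_val F) (poly_val G)) c))"

end

theory Submission
  imports Defs
begin

text \<open>
  The pairs \<open>(A, B)\<close> with \<open>A = B S\<close> modulo \<open>X ^ l\<close> form a free module of rank two. A basis that is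
  minimal for the degree of \<open>A\<close> and the degree of \<open>B\<close> shifted by \<open>m\<close> determines the coprime monic
  solution: by Cramer's rule the solution is a combination of the two basis rows whose coefficients
  have degrees so small that it must be a scalar multiple of one explicitly computable row. This
  also gives uniqueness.

  A minimal basis modulo \<open>X ^ n\<close> is obtained by divide and conquer: the basis modulo \<open>X ^ h\<close> for
  \<open>h = n div 2\<close> is multiplied by a basis for the residuals divided by \<open>X ^ h\<close>. Modulo \<open>X\<close>, a single
  elimination step on the constant coefficients suffices. No division with remainder is needed, and
  as each level of the recursion costs a bounded number of multiplications of degree \<open>n\<close>, the total
  cost is that of multiplication times a logarithm.
\<close>

section \<open>Identities in commutative rings\<close>

text \<open>The weight \<open>m\<close> on the second column gives F and G the same weighted degree
  a = deg F, and deg F + deg G <= l becomes 2 a <= l + m. The two row degrees of the basis add up to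
  exactly l + m, so the solution is at most as long as the average row, and the coefficient of a
  strictly longer row is zero. The obstacle is a tie of the row degrees, where both coefficients may
  be nonzero constants; there the monicity of F and G supplies the missing linear condition.
  Minimality is never expressed by a matrix of leading coefficients: a determinant c X^n together
  with row bounds that add up to the weights plus n certifies it, and this certificate survives
  matrix products. On the cost side, the given bound \<open>TM\<close> is an arbitrary function in
  O(n log n), possibly neither monotone nor superadditive; it is majorised by n times a common rate,
  the maximum of TM k / k (up to rounding) over all sizes up to l.\<close>

lemma (in cring) det_mult:
  assumes "a \<in> carrier R" "b \<in> carrier R" "c \<in> carrier R" "d \<in> carrier R"
    "e \<in> carrier R" "f \<in> carrier R" "g \<in> carrier R" "h \<in> carrier R"
  shows "(e \<otimes> a \<oplus> f \<otimes> c) \<otimes> (g \<otimes> b \<oplus> h \<otimes> d) \<ominus> (g \<otimes> a \<oplus> h \<otimes> c) \<otimes> (e \<otimes> b \<oplus> f \<otimes> d)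
    = (e \<otimes> h \<ominus> g \<otimes> f) \<otimes> (a \<otimes> d \<ominus> c \<otimes> b)"
  using assms by algebra

text \<open>Associativity of row times matrix times column, for the row (a, c), the matrix ((b, e),
  (d, g)) and the column (f, h).\<close>

lemma (in cring) row_mult:
  assumes "a \<in> carrier R" "b \<in> carrier R" "c \<in> carrier R" "d \<in> carrier R"
    "e \<in> carrier R" "f \<in> carrier R" "g \<in> carrier R" "h \<in> carrier R"
  shows "(a \<otimes> b \<oplus> c \<otimes> d) \<otimes> f \<oplus> (a \<otimes> e \<oplus> c \<otimes> g) \<otimes> h = a \<otimes> (b \<otimes> f \<oplus> e \<otimes> h) \<oplus> c \<otimes> (d \<otimes> f \<oplus> g \<otimes> h)"
  using assms by (simp add: l_distr r_distr m_ac a_ac)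

text \<open>A Cramer numerator becomes a combination of the residual of a basis row and the residual
  of the solution. Both residuals are divisible by X^l, hence so is the numerator.\<close>

lemma (in cring) cramer_residual1:
  assumes "f \<in> carrier R" "g \<in> carrier R" "s \<in> carrier R" "a \<in> carrier R"
    "b \<in> carrier R"
  shows "f \<otimes> b \<ominus> g \<otimes> a = g \<otimes> (a \<otimes> (\<ominus> \<one>) \<oplus> b \<otimes> s) \<ominus> b \<otimes> (s \<otimes> g \<ominus> f)"
  using assms by algebra

lemma (in cring) cramer_residual2:
  assumes "f \<in> carrier R" "g \<in> carrier R" "s \<in> carrier R" "a \<in> carrier R"
    "b \<in> carrier R"
  shows "a \<otimes> g \<ominus> b \<otimes> f = b \<otimes> (s \<otimes> g \<ominus> f) \<ominus> g \<otimes> (a \<otimes> (\<ominus> \<one>) \<oplus> b \<otimes> s)"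
  using assms by algebra

text \<open>The adjugate recovers the solution times the determinant from the two numerators;
  cancelling X^l there leaves a scalar factor.\<close>

lemma (in cring) cramer_sum1:
  assumes "f \<in> carrier R" "g \<in> carrier R" "a \<in> carrier R" "b \<in> carrier R"
    "c \<in> carrier R" "d \<in> carrier R"
  shows "(f \<otimes> d \<ominus> g \<otimes> c) \<otimes> a \<oplus> (a \<otimes> g \<ominus> b \<otimes> f) \<otimes> c = f \<otimes> (a \<otimes> d \<ominus> c \<otimes> b)"
  using assms by algebra

lemma (in cring) cramer_sum2:
  assumes "f \<in> carrier R" "g \<in> carrier R" "a \<in> carrier R" "b \<in> carrier R"
    "c \<in> carrier R" "d \<in> carrier R"
  shows "(f \<otimes> d \<ominus> g \<otimes> c) \<otimes> b \<oplus> (a \<otimes> g \<ominus> b \<otimes> f) \<otimes> d = g \<otimes> (a \<otimes> d \<ominus> c \<otimes> b)"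
  using assms by algebra

lemma (in cring) row_add:
  assumes "f \<in> carrier R" "f' \<in> carrier R" "g \<in> carrier R" "g' \<in> carrier R"
    "a \<in> carrier R" "b \<in> carrier R" "x \<in> carrier R"
  shows "a \<otimes> (f \<oplus> x \<otimes> f') \<oplus> b \<otimes> (g \<oplus> x \<otimes> g') = (a \<otimes> f \<oplus> b \<otimes> g) \<oplus> x \<otimes> (a \<otimes> f' \<oplus> b \<otimes> g')"
  using assms by (simp add: l_distr r_distr m_ac a_ac)

lemma (in cring) residual_diff:
  assumes "s \<in> carrier R" "t \<in> carrier R" "f \<in> carrier R" "g \<in> carrier R"
  shows "(s \<ominus> t) \<otimes> g = (s \<otimes> g \<ominus> f) \<ominus> (t \<otimes> g \<ominus> f)"
  using assms by algebra

lemma (in cring) residual_update: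
  assumes "s \<in> carrier R" "x \<in> carrier R" "y \<in> carrier R" "f \<in> carrier R"
    "g \<in> carrier R"
  shows "(s \<ominus> x \<otimes> y) \<otimes> g \<ominus> f = (s \<otimes> g \<ominus> f) \<ominus> x \<otimes> (y \<otimes> g)"
  using assms by algebra

section \<open>Polynomials over a field\<close>

locale field_polynomials = field R for R (structure) +
  fixes P defines P_def: "P \<equiv> poly_ring R"
begin

sublocale P: domain P
  unfolding P_def by (rule univ_poly_is_domain[OF carrier_is_subring])

section \<open>Ring operations in terms of coefficients\<close>

lemma carrierP_iff: "A \<in> carrier P \<longleftrightarrow> polynomial (carrier R) A"
  unfolding P_def by (simp add: univ_poly_carrier)

lemma set_carrierP: "A \<in> carrier P \<Longrightarrow> set A \<subseteq> carrier R"
  by (auto simp: carrierP_iff polynomial_def)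

lemma zeroP: "\<zero>\<^bsub>P\<^esub> = []" and oneP: "\<one>\<^bsub>P\<^esub> = [\<one>]"
  and addP: "A \<oplus>\<^bsub>P\<^esub> B = poly_add A B" and multP: "A \<otimes>\<^bsub>P\<^esub> B = poly_mult A B"
  by (simp_all add: P_def univ_poly_zero univ_poly_one univ_poly_add univ_poly_mult)

lemma const_closed [simp]: "a \<in> carrier R \<Longrightarrow> a \<noteq> \<zero> \<Longrightarrow> [a] \<in> carrier P"
  by (simp add: carrierP_iff polynomial_def)

lemma X_closed [simp]: "X \<in> carrier P"
  unfolding P_def by (rule var_closed(1)[OF carrier_is_subring])

lemma coeff_closed [simp]: "A \<in> carrier P \<Longrightarrow> coeff A i \<in> carrier R"
  by (simp add: set_carrierP)

lemma poly_eqI: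
  assumes "A \<in> carrier P" "B \<in> carrier P" "\<And>i. coeff A i = coeff B i"
  shows "A = B"
  using coeff_iff_polynomial_cond[of "carrier R" A B] assms by (auto simp: carrierP_iff)

lemma coeff_zeroP [simp]: "coeff \<zero>\<^bsub>P\<^esub> i = \<zero>"
  by (simp add: zeroP)

lemma coeff_add:
  "A \<in> carrier P \<Longrightarrow> B \<in> carrier P \<Longrightarrow> coeff (A \<oplus>\<^bsub>P\<^esub> B) i = coeff A i \<oplus> coeff B i"
  using poly_add_coeff[of A B] by (simp add: addP set_carrierP)

lemma coeff_neg:
  assumes "A \<in> carrier P"
  shows "coeff (\<ominus>\<^bsub>P\<^esub> A) i = \<ominus> coeff A i"
proof -
  have "coeff (\<ominus>\<^bsub>P\<^esub> A) i \<oplus> coeff A i = coeff (\<ominus>\<^bsub>P\<^esub> A \<oplus>\<^bsub>P\<^esub> A) i"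
    using assms by (simp add: coeff_add)
  also have "\<dots> = \<zero>" using assms by (simp add: P.l_neg)
  finally show ?thesis
    using assms by (metis P.a_inv_closed coeff_closed minus_equality)
qed

lemma coeff_minus:
  "A \<in> carrier P \<Longrightarrow> B \<in> carrier P \<Longrightarrow> coeff (A \<ominus>\<^bsub>P\<^esub> B) i = coeff A i \<ominus> coeff B i"
  by (simp add: P.minus_eq minus_eq coeff_add coeff_neg)

lemma coeff_mult:
  "A \<in> carrier P \<Longrightarrow> B \<in> carrier P \<Longrightarrow>
    coeff (A \<otimes>\<^bsub>P\<^esub> B) i = (\<Oplus>k \<in> {..i}. coeff A k \<otimes> coeff B (i - k))"
  using poly_mult_coeff[of A B] by (simp add: multP set_carrierP)

lemma coeff_const_mult:
  assumes "a \<in> carrier R" "a \<noteq> \<zero>" "A \<in> carrier P"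
  shows "coeff ([a] \<otimes>\<^bsub>P\<^esub> A) i = a \<otimes> coeff A i"
  using assms poly_mult_const(1)[OF carrier_is_subring, of A a] scalar_coeff[of a A]
  by (simp add: multP carrierP_iff)

lemma coeff_X_mult:
  assumes "A \<in> carrier P"
  shows "coeff (X \<otimes>\<^bsub>P\<^esub> A) i = (if i = 0 then \<zero> else coeff A (i - 1))"
proof -
  have "coeff (X \<otimes>\<^bsub>P\<^esub> A) = coeff (A @ [\<zero>])"
    using poly_mult_var'(1)[of A] assms normalize_coeff[of "A @ [\<zero>]", symmetric]
    by (simp add: multP set_carrierP)
  then show ?thesis by (simp add: append_coeff)
qed

lemma Xpow_closed [simp]: "X [^]\<^bsub>P\<^esub> (n::nat) \<in> carrier P"
  by simp

lemma Xpow_Suc_mult: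
  assumes "A \<in> carrier P"
  shows "X [^]\<^bsub>P\<^esub> Suc n \<otimes>\<^bsub>P\<^esub> A = X \<otimes>\<^bsub>P\<^esub> (X [^]\<^bsub>P\<^esub> n \<otimes>\<^bsub>P\<^esub> A)"
  using assms by (simp add: P.m_comm P.m_lcomm P.m_assoc)

lemma coeff_Xpow_mult:
  assumes "A \<in> carrier P"
  shows "coeff (X [^]\<^bsub>P\<^esub> n \<otimes>\<^bsub>P\<^esub> A) i = (if i < n then \<zero> else coeff A (i - n))"
proof (induction n arbitrary: i)
  case 0
  then show ?case using assms by simp
next
  case (Suc n)
  have "coeff (X [^]\<^bsub>P\<^esub> Suc n \<otimes>\<^bsub>P\<^esub> A) i = (if i = 0 then \<zero> else coeff (X [^]\<^bsub>P\<^esub> n \<otimes>\<^bsub>P\<^esub> A) (i - 1))"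
    unfolding Xpow_Suc_mult[OF assms] using assms by (simp add: coeff_X_mult)
  then show ?case by (auto simp: Suc)
qed

lemma Xpow_nonzero: "X [^]\<^bsub>P\<^esub> (n::nat) \<noteq> \<zero>\<^bsub>P\<^esub>"
proof
  assume zero: "X [^]\<^bsub>P\<^esub> n = \<zero>\<^bsub>P\<^esub>"
  have "coeff (X [^]\<^bsub>P\<^esub> n \<otimes>\<^bsub>P\<^esub> \<one>\<^bsub>P\<^esub>) n = \<one>"
    by (subst coeff_Xpow_mult) (simp_all add: oneP)
  moreover have "coeff (X [^]\<^bsub>P\<^esub> n \<otimes>\<^bsub>P\<^esub> \<one>\<^bsub>P\<^esub>) n = \<zero>"
    unfolding zero by simp
  ultimately show False by simp
qed

lemma Xpow_cancel:
  assumes "X [^]\<^bsub>P\<^esub> (n::nat) \<otimes>\<^bsub>P\<^esub> A = X [^]\<^bsub>P\<^esub> n \<otimes>\<^bsub>P\<^esub> B" "A \<in> carrier P" "B \<in> carrier P"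
  shows "A = B"
  using assms P.m_lcancel[OF Xpow_nonzero Xpow_closed, of A B n] by simp

text \<open>Coefficients are stored leading one first, so the low part of a list is its end. The
  remainder may begin with zeros and needs \<open>normalize\<close>; the quotient
  \<open>shift\<close> is a prefix and keeps its leading coefficient. Truncated subtraction makes an
  \<open>n\<close> beyond the length harmless.\<close>

definition trunc :: "nat \<Rightarrow> 'a list \<Rightarrow> 'a list" where
  "trunc n A = normalize (drop (length A - n) A)"

definition shift :: "nat \<Rightarrow> 'a list \<Rightarrow> 'a list" where
  "shift n A = take (length A - n) A"

lemma trunc_closed [simp]:
  assumes "A \<in> carrier P" shows "trunc n A \<in> carrier P"
  unfolding trunc_def carrierP_iff
  by (intro normalize_gives_polynomial) (use assms set_carrierP[of A] set_drop_subset[of "length A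
      - n" A] in auto)

lemma shift_closed [simp]:
  assumes "A \<in> carrier P" shows "shift n A \<in> carrier P"
  using assms set_take_subset[of "length A - n" A]
  by (auto simp: shift_def carrierP_iff polynomial_def)

lemma coeff_shift: "coeff (shift n A) i = coeff A (i + n)"
proof (cases "n \<le> length A")
  case True
  have "coeff A (i + n) = coeff (shift n A @ drop (length A - n) A) (i + n)"
    by (simp add: shift_def)
  then show ?thesis using True by (subst (asm) append_coeff) simp
next
  case False
  then show ?thesis by (simp add: shift_def coeff_length)
qed

lemma coeff_trunc: "coeff (trunc n A) i = (if i < n then coeff A i else \<zero>)"
proof (cases "n \<le> length A")
  case True
  have "coeff A i = coeff (shift n A @ drop (length A - n) A) i"
    by (simp add: shift_def)
  then show ?thesis using True
    by (subst (asm) append_coeff)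
      (auto simp: trunc_def normalize_coeff[symmetric] coeff_length)
next
  case False
  then show ?thesis by (auto simp: trunc_def normalize_coeff[symmetric] coeff_length)
qed

lemma trunc_shift:
  assumes "A \<in> carrier P"
  shows "A = trunc n A \<oplus>\<^bsub>P\<^esub> X [^]\<^bsub>P\<^esub> n \<otimes>\<^bsub>P\<^esub> shift n A"
  by (rule poly_eqI)
    (use assms in \<open>auto simp: coeff_add coeff_trunc coeff_Xpow_mult coeff_shift\<close>)

definition vanishes :: "nat \<Rightarrow> 'a list \<Rightarrow> bool" where
  "vanishes n A \<longleftrightarrow> (\<exists>D \<in> carrier P. A = X [^]\<^bsub>P\<^esub> n \<otimes>\<^bsub>P\<^esub> D)"

lemma vanishes_iff:
  assumes "A \<in> carrier P"
  shows "vanishes n A \<longleftrightarrow> (\<forall>i < n. coeff A i = \<zero>)"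
proof
  assume "vanishes n A"
  then show "\<forall>i < n. coeff A i = \<zero>" by (auto simp: vanishes_def coeff_Xpow_mult)
next
  assume "\<forall>i < n. coeff A i = \<zero>"
  then have "A = X [^]\<^bsub>P\<^esub> n \<otimes>\<^bsub>P\<^esub> shift n A"
    by (intro poly_eqI) (use assms in \<open>auto simp: coeff_Xpow_mult coeff_shift\<close>)
  then show "vanishes n A" using assms by (auto simp: vanishes_def)
qed

lemma vanishes_shift:
  "A \<in> carrier P \<Longrightarrow> vanishes n A \<Longrightarrow> A = X [^]\<^bsub>P\<^esub> n \<otimes>\<^bsub>P\<^esub> shift n A"
  by (intro poly_eqI) (auto simp: coeff_Xpow_mult coeff_shift vanishes_iff)

text \<open>
  The bound is an integer, so that a negative one characterises the zero polynomial, which the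
  library gives degree \<open>0\<close>.
\<close>

definition deg_le :: "'a list \<Rightarrow> int \<Rightarrow> bool" where
  "deg_le A d \<longleftrightarrow> (\<forall>i. d < int i \<longrightarrow> coeff A i = \<zero>)"

lemma deg_le_mono: "deg_le A d \<Longrightarrow> d \<le> e \<Longrightarrow> deg_le A e"
  by (auto simp: deg_le_def)

lemma deg_le_zero [simp]: "deg_le [] d"
  by (simp add: deg_le_def)

lemma deg_le_degree: "deg_le A (int (degree A))"
  by (auto simp: deg_le_def intro: coeff_degree)

lemma deg_le_const: "0 \<le> d \<Longrightarrow> deg_le [a] d"
  using deg_le_mono[OF deg_le_degree, of "[a]" d] by simp

lemma deg_le_X: "1 \<le> d \<Longrightarrow> deg_le X d"
  using deg_le_mono[OF deg_le_degree, of X d] by (simp add: var_def)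

lemma deg_le_add:
  "deg_le A d \<Longrightarrow> deg_le B d \<Longrightarrow> A \<in> carrier P \<Longrightarrow> B \<in> carrier P \<Longrightarrow> deg_le (A \<oplus>\<^bsub>P\<^esub> B) d"
  by (simp add: deg_le_def coeff_add)

lemma deg_le_minus:
  "deg_le A d \<Longrightarrow> deg_le B d \<Longrightarrow> A \<in> carrier P \<Longrightarrow> B \<in> carrier P \<Longrightarrow> deg_le (A \<ominus>\<^bsub>P\<^esub> B) d"
  by (simp add: deg_le_def coeff_minus minus_eq)

lemma deg_le_mult:
  assumes "deg_le A d" "deg_le B e" "A \<in> carrier P" "B \<in> carrier P" "d + e \<le> s"
  shows "deg_le (A \<otimes>\<^bsub>P\<^esub> B) s"
  unfolding deg_le_def
proof (intro allI impI)
  fix i assume i: "s < int i"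
  have "coeff A k \<otimes> coeff B (i - k) = \<zero>" if "k \<le> i" for k
  proof (cases "d < int k")
    case True
    then show ?thesis using assms by (simp add: deg_le_def)
  next
    case False
    then have "e < int (i - k)" using i that assms(5) by linarith
    then show ?thesis using assms by (simp add: deg_le_def)
  qed
  then show "coeff (A \<otimes>\<^bsub>P\<^esub> B) i = \<zero>"
    using assms by (simp add: coeff_mult cong: finsum_cong)
qed

lemma coeff_mult_top:
  assumes "deg_le A (int d)" "deg_le B (int e)" "A \<in> carrier P" "B \<in> carrier P"
  shows "coeff (A \<otimes>\<^bsub>P\<^esub> B) (d + e) = coeff A d \<otimes> coeff B e"
proof -
  have "coeff A k \<otimes> coeff B (d + e - k) = (if d = k then coeff A d \<otimes> coeff B e else \<zero>)"
    if "k \<le> d + e" for k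
    using that assms by (cases "d < k"; cases "k < d") (auto simp: deg_le_def)
  then have "coeff (A \<otimes>\<^bsub>P\<^esub> B) (d + e) =
      (\<Oplus>k \<in> {..d + e}. if d = k then coeff A d \<otimes> coeff B e else \<zero>)"
    using assms by (simp add: coeff_mult cong: finsum_cong)
  also have "\<dots> = coeff A d \<otimes> coeff B e"
    using assms finsum_singleton[of d "{..d+e}" "\<lambda>k. coeff A d \<otimes> coeff B e"] by simp
  finally show ?thesis .
qed

lemma deg_le_length:
  assumes "A \<in> carrier P"
  shows "deg_le A (int n) \<longleftrightarrow> length A \<le> Suc n"
proof
  assume *: "deg_le A (int n)"
  show "length A \<le> Suc n"
  proof (rule ccontr)
    assume "\<not> length A \<le> Suc n"
    then have "A \<noteq> []" "coeff A (degree A) = \<zero>" using * by (auto simp: deg_le_def)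
    then show False using assms lead_coeff_simp[of A] by (auto simp: carrierP_iff polynomial_def)
  qed
qed (auto simp: deg_le_def intro!: coeff_length)

lemma deg_le_neg:
  assumes "A \<in> carrier P" "deg_le A d" "d < 0" shows "A = []"
  using poly_eqI[OF assms(1), of "[]"] assms P.zero_closed by (auto simp: deg_le_def zeroP)

lemma deg_le_Xpow_mult:
  assumes "deg_le (X [^]\<^bsub>P\<^esub> n \<otimes>\<^bsub>P\<^esub> A) d" "A \<in> carrier P"
  shows "deg_le A (d - int n)"
  unfolding deg_le_def
proof (intro allI impI)
  fix i assume "d - int n < int i"
  then have "d < int (i + n)" by linarith
  then have "coeff (X [^]\<^bsub>P\<^esub> n \<otimes>\<^bsub>P\<^esub> A) (i + n) = \<zero>" using assms(1) unfolding deg_le_def by blast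
  then show "coeff A i = \<zero>" using assms(2) by (simp add: coeff_Xpow_mult)
qed

section \<open>Order bases\<close>

abbreviation multX (infixl \<open>\<boxtimes>\<close> 70) where "A \<boxtimes> B \<equiv> A \<otimes>\<^bsub>P\<^esub> B"
abbreviation addX (infixl \<open>\<boxplus>\<close> 65) where "A \<boxplus> B \<equiv> A \<oplus>\<^bsub>P\<^esub> B"
abbreviation minusX (infixl \<open>\<boxminus>\<close> 65) where "A \<boxminus> B \<equiv> A \<ominus>\<^bsub>P\<^esub> B"
abbreviation Xpow where "Xpow (n::nat) \<equiv> X [^]\<^bsub>P\<^esub> n"

text \<open>
  If \<open>X\<close> does not divide both \<open>f\<close> and \<open>g\<close>, then the rows \<open>(A1, B1)\<close> and \<open>(A2, B2)\<close> form a basis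
  of the module of all \<open>(A, B)\<close> with \<open>A f + B g = 0\<close> modulo \<open>X ^ n\<close>. The integers \<open>v1\<close>, \<open>v2\<close> bound
  their degrees with respect to the weights \<open>w1\<close>, \<open>w2\<close> of the two columns. As \<open>v1 + v2 = w1 + w2 + n\<close> is attained by the determinant,
  the matrix of leading coefficients is invertible, and hence the basis is minimal.
\<close>

definition order_basis ::
  "nat \<Rightarrow> int \<Rightarrow> int \<Rightarrow> 'a list \<Rightarrow> 'a list \<Rightarrow> 'a list \<Rightarrow> 'a list \<Rightarrow> 'a list \<Rightarrow> 'a list \<Rightarrow> int \<Rightarrow> int \<Rightarrow> bool"
  where
  "order_basis n w1 w2 f g A1 B1 A2 B2 v1 v2 \<longleftrightarrow>
     {A1, B1, A2, B2} \<subseteq> carrier P \<and>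
     (\<exists>c \<in> carrier R - {\<zero>}. A1 \<boxtimes> B2 \<boxminus> A2 \<boxtimes> B1 = [c] \<boxtimes> Xpow n) \<and>
     vanishes n (A1 \<boxtimes> f \<boxplus> B1 \<boxtimes> g) \<and> vanishes n (A2 \<boxtimes> f \<boxplus> B2 \<boxtimes> g) \<and>
     v1 + v2 = w1 + w2 + int n \<and>
     deg_le A1 (v1 - w1) \<and> deg_le B1 (v1 - w2) \<and> deg_le A2 (v2 - w1) \<and> deg_le B2 (v2 - w2) \<and>
     deg_le A1 n \<and> deg_le B1 n \<and> deg_le A2 n \<and> deg_le B2 n"

lemma vanishes_closed: "vanishes n A \<Longrightarrow> A \<in> carrier P"
  by (auto simp: vanishes_def)

lemma vanishes_add: "vanishes n A \<Longrightarrow> vanishes n B \<Longrightarrow> vanishes n (A \<boxplus> B)"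
  using vanishes_closed[of n A] vanishes_closed[of n B] by (simp add: vanishes_iff coeff_add)

lemma vanishes_mult: "vanishes n A \<Longrightarrow> B \<in> carrier P \<Longrightarrow> vanishes n (B \<boxtimes> A)"
  by (simp add: vanishes_def) (metis P.m_closed P.m_lcomm Xpow_closed)

lemma vanishes_Xpow_mult:
  assumes "vanishes k A" shows "vanishes (n + k) (Xpow n \<boxtimes> A)"
proof -
  obtain D where "D \<in> carrier P" "A = Xpow k \<boxtimes> D" using assms by (auto simp: vanishes_def)
  then have "Xpow n \<boxtimes> A = Xpow (n + k) \<boxtimes> D" by (simp add: P.nat_pow_mult[symmetric] P.m_assoc)
  then show ?thesis using \<open>D \<in> carrier P\<close> by (auto simp: vanishes_def)
qed

lemma const_mult_Xpow:
  assumes "a \<in> carrier R - {\<zero>}" "b \<in> carrier R - {\<zero>}"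
  shows "([a] \<boxtimes> Xpow n) \<boxtimes> ([b] \<boxtimes> Xpow k) = [a \<otimes> b] \<boxtimes> Xpow (n + k)"
proof -
  have "[a] \<boxtimes> [b] = [a \<otimes> b]"
    using assms poly_mult_const(1)[OF carrier_is_subring, of "[b]" a]
    by (simp add: multP polynomial_def)
  moreover have "([a] \<boxtimes> Xpow n) \<boxtimes> ([b] \<boxtimes> Xpow k) = ([a] \<boxtimes> [b]) \<boxtimes> (Xpow n \<boxtimes> Xpow k)"
    using assms by (simp add: P.m_ac)
  ultimately show ?thesis by (simp add: P.nat_pow_mult)
qed

text \<open>The entries of a row of the second matrix multiply the two rows of the first one, so the
  second basis is taken for the weights \<open>v1\<close>, \<open>v2\<close>, the row degrees
  already reached. The determinants multiply to a constant times X^(n+k). The bounds by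
  \<open>n + k\<close> that ignore the weights are carried along because they fix the size at which
  multiplications are charged.\<close>

lemma order_basis_compose:
  assumes Q: "order_basis n w1 w2 f g A1 B1 A2 B2 v1 v2"
    and f: "f \<in> carrier P" and g: "g \<in> carrier P"
    and C: "order_basis k v1 v2 (shift n (A1 \<boxtimes> f \<boxplus> B1 \<boxtimes> g)) (shift n (A2 \<boxtimes> f \<boxplus> B2 \<boxtimes> g)) C1 D1 C2
        D2 u1 u2"
  shows "order_basis (n + k) w1 w2 f g
     (C1 \<boxtimes> A1 \<boxplus> D1 \<boxtimes> A2) (C1 \<boxtimes> B1 \<boxplus> D1 \<boxtimes> B2) (C2 \<boxtimes> A1 \<boxplus> D2 \<boxtimes> A2) (C2 \<boxtimes> B1 \<boxplus> D2 \<boxtimes> B2) u1 u2"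
proof -
  have cl: "A1 \<in> carrier P" "B1 \<in> carrier P" "A2 \<in> carrier P" "B2 \<in> carrier P"
    "C1 \<in> carrier P" "D1 \<in> carrier P" "C2 \<in> carrier P" "D2 \<in> carrier P"
    using Q C by (simp_all add: order_basis_def)
  let ?r = "A1 \<boxtimes> f \<boxplus> B1 \<boxtimes> g" and ?s = "A2 \<boxtimes> f \<boxplus> B2 \<boxtimes> g"
  have r: "?r = Xpow n \<boxtimes> shift n ?r" and s: "?s = Xpow n \<boxtimes> shift n ?s"
    using Q cl f g by (auto simp: order_basis_def intro!: vanishes_shift)
  have van: "vanishes (n + k) ((C \<boxtimes> A1 \<boxplus> D \<boxtimes> A2) \<boxtimes> f \<boxplus> (C \<boxtimes> B1 \<boxplus> D \<boxtimes> B2) \<boxtimes> g)"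
    if "vanishes k (C \<boxtimes> shift n ?r \<boxplus> D \<boxtimes> shift n ?s)" "C \<in> carrier P" "D \<in> carrier P" for C D
  proof -
    have "C \<boxtimes> (Xpow n \<boxtimes> shift n ?r) \<boxplus> D \<boxtimes> (Xpow n \<boxtimes> shift n ?s) =
        Xpow n \<boxtimes> (C \<boxtimes> shift n ?r \<boxplus> D \<boxtimes> shift n ?s)"
      using that cl f g by (simp add: P.m_lcomm P.r_distr)
    then show ?thesis
      unfolding P.row_mult[OF that(2) cl(1) that(3) cl(3,2) f cl(4) g]
      using r s vanishes_Xpow_mult[OF that(1), of n] by simp
  qed
  obtain a b where ab: "a \<in> carrier R - {\<zero>}" "b \<in> carrier R - {\<zero>}"
    "A1 \<boxtimes> B2 \<boxminus> A2 \<boxtimes> B1 = [a] \<boxtimes> Xpow n" "C1 \<boxtimes> D2 \<boxminus> C2 \<boxtimes> D1 = [b] \<boxtimes> Xpow k"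
    using Q C by (auto simp: order_basis_def)
  have "(C1 \<boxtimes> A1 \<boxplus> D1 \<boxtimes> A2) \<boxtimes> (C2 \<boxtimes> B1 \<boxplus> D2 \<boxtimes> B2) \<boxminus> (C2 \<boxtimes> A1 \<boxplus> D2 \<boxtimes> A2) \<boxtimes> (C1 \<boxtimes> B1 \<boxplus> D1 \<boxtimes> B2)
      = [b \<otimes> a] \<boxtimes> Xpow (k + n)"
    using cl ab by (subst P.det_mult) (auto simp: const_mult_Xpow)
  moreover have "b \<otimes> a \<in> carrier R - {\<zero>}" using ab by (auto simp: integral_iff)
  ultimately have "\<exists>c \<in> carrier R - {\<zero>}. (C1 \<boxtimes> A1 \<boxplus> D1 \<boxtimes> A2) \<boxtimes> (C2 \<boxtimes> B1 \<boxplus> D2 \<boxtimes> B2)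
      \<boxminus> (C2 \<boxtimes> A1 \<boxplus> D2 \<boxtimes> A2) \<boxtimes> (C1 \<boxtimes> B1 \<boxplus> D1 \<boxtimes> B2) = [c] \<boxtimes> Xpow (n + k)"
    by (metis add.commute)
  moreover have "deg_le (C1 \<boxtimes> A1 \<boxplus> D1 \<boxtimes> A2) (u1 - w1)" "deg_le (C1 \<boxtimes> B1 \<boxplus> D1 \<boxtimes> B2) (u1 - w2)"
     "deg_le (C2 \<boxtimes> A1 \<boxplus> D2 \<boxtimes> A2) (u2 - w1)" "deg_le (C2 \<boxtimes> B1 \<boxplus> D2 \<boxtimes> B2) (u2 - w2)"
    using Q C cl unfolding order_basis_def
    by (auto intro!: deg_le_add intro: deg_le_mult)
  moreover have "deg_le (C1 \<boxtimes> A1 \<boxplus> D1 \<boxtimes> A2) (n + k)" "deg_le (C1 \<boxtimes> B1 \<boxplus> D1 \<boxtimes> B2) (n + k)"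
     "deg_le (C2 \<boxtimes> A1 \<boxplus> D2 \<boxtimes> A2) (n + k)" "deg_le (C2 \<boxtimes> B1 \<boxplus> D2 \<boxtimes> B2) (n + k)"
    using Q C cl unfolding order_basis_def
    by (auto intro!: deg_le_add intro: deg_le_mult)
  ultimately show ?thesis
    using Q C cl unfolding order_basis_def by (auto intro!: van)
qed

text \<open>Passing to remainders changes a residual only by a multiple of X^n. This keeps the
  operands of every recursive call at the size of that call.\<close>

lemma order_basis_trunc:
  assumes Q: "order_basis n w1 w2 (trunc n f) (trunc n g) A1 B1 A2 B2 v1 v2"
    and f: "f \<in> carrier P" and g: "g \<in> carrier P"
  shows "order_basis n w1 w2 f g A1 B1 A2 B2 v1 v2"
proof -
  have "vanishes n (A \<boxtimes> f \<boxplus> B \<boxtimes> g)"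
    if "vanishes n (A \<boxtimes> trunc n f \<boxplus> B \<boxtimes> trunc n g)" and c: "A \<in> carrier P" "B \<in> carrier P" for A B
  proof -
    have "A \<boxtimes> f \<boxplus> B \<boxtimes> g = (A \<boxtimes> trunc n f \<boxplus> B \<boxtimes> trunc n g) \<boxplus> Xpow n \<boxtimes> (A \<boxtimes> shift n f \<boxplus> B \<boxtimes> shift n
        g)"
      using P.row_add[OF trunc_closed[OF f] shift_closed[OF f] trunc_closed[OF g] shift_closed[OF g]
          c Xpow_closed, of n n n n n]
      unfolding trunc_shift[OF f, symmetric] trunc_shift[OF g, symmetric] .
    moreover have "vanishes n (Xpow n \<boxtimes> (A \<boxtimes> shift n f \<boxplus> B \<boxtimes> shift n g))"
      using c f g by (auto simp: vanishes_def)
    ultimately show ?thesis using that(1) by (simp add: vanishes_add)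
  qed
  then show ?thesis using Q unfolding order_basis_def by simp
qed

lemma vanishes_1:
  assumes "A \<in> carrier P" shows "vanishes 1 A \<longleftrightarrow> coeff A 0 = \<zero>"
  using assms by (simp add: vanishes_iff)

lemma const_mult_id [simp]:
  shows "A \<in> carrier P \<Longrightarrow> [\<one>] \<boxtimes> A = A" "A \<in> carrier P \<Longrightarrow> A \<boxtimes> [\<one>] = A"
    "A \<in> carrier P \<Longrightarrow> [] \<boxtimes> A = []" "A \<in> carrier P \<Longrightarrow> A \<boxtimes> [] = []"
    "A \<in> carrier P \<Longrightarrow> A \<boxplus> [] = A" "A \<in> carrier P \<Longrightarrow> [] \<boxplus> A = A" "A \<in> carrier P \<Longrightarrow> A \<boxminus> [] = A"
    "A \<in> carrier P \<Longrightarrow> [] \<boxminus> A = \<ominus>\<^bsub>P\<^esub> A" "[] \<in> carrier P" "[\<one>] \<in> carrier P"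
  using P.l_one P.r_one P.l_null P.r_null P.l_zero P.r_zero P.zero_closed P.one_closed
      P.minus_eq[of A] P.minus_eq[of _ A]
    P.minus_zero by (simp_all add: zeroP oneP)

lemma neg_const: "a \<in> carrier R - {\<zero>} \<Longrightarrow> \<ominus>\<^bsub>P\<^esub> [a] = [\<ominus> a]"
  using univ_poly_a_inv_def'[OF carrier_is_subring, of "[a]"] const_closed[of a] by (simp add:
      P_def)

text \<open>A nonzero constant coefficient serves as pivot: its row clears the other one and is then
  multiplied by X, which raises its degree by one. With two nonzero coefficients the pivot is a row
  of smaller weight, since adding a multiple of it leaves the degree bound of the other row
  intact.\<close>

lemma order_basis_step:
  assumes f: "f \<in> carrier P" and g: "g \<in> carrier P"
    and a: "a = coeff f 0" and b: "b = coeff g 0"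
  shows "a = \<zero> \<Longrightarrow> order_basis 1 w1 w2 f g [\<one>] [] [] X w1 (w2 + 1)"
    and "b = \<zero> \<Longrightarrow> order_basis 1 w1 w2 f g X [] [] [\<one>] (w1 + 1) w2"
    and "a \<noteq> \<zero> \<Longrightarrow> b \<noteq> \<zero> \<Longrightarrow> w1 \<le> w2 \<Longrightarrow>
      order_basis 1 w1 w2 f g X [] [\<ominus> (b \<otimes> inv a)] [\<one>] (w1 + 1) w2"
    and "a \<noteq> \<zero> \<Longrightarrow> b \<noteq> \<zero> \<Longrightarrow> w2 \<le> w1 \<Longrightarrow>
      order_basis 1 w1 w2 f g [\<one>] [\<ominus> (a \<otimes> inv b)] [] X w1 (w2 + 1)"
proof -
  have ab: "a \<in> carrier R" "b \<in> carrier R" using a b f g by auto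
  have X0: "coeff (X \<boxtimes> A) 0 = \<zero>" if "A \<in> carrier P" for A
    using that by (simp add: coeff_X_mult)
  have q: "\<ominus> (y \<otimes> inv x) \<in> carrier R - {\<zero>}" "\<ominus> (y \<otimes> inv x) \<otimes> x \<oplus> y = \<zero>"
    if "x \<in> carrier R" "y \<in> carrier R" "x \<noteq> \<zero>" "y \<noteq> \<zero>" for x y
  proof -
    have x: "x \<in> Units R" using that by (simp add: field_Units)
    then have "y \<otimes> inv x \<noteq> \<zero>" using that by (metis Units_inv_closed Units_l_inv Units_closed
        m_assoc r_one l_null)
    then show "\<ominus> (y \<otimes> inv x) \<in> carrier R - {\<zero>}" using x that by auto
    have "\<ominus> (y \<otimes> inv x) \<otimes> x = \<ominus> (y \<otimes> (inv x \<otimes> x))"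
      using x that by (simp add: l_minus m_assoc)
    then show "\<ominus> (y \<otimes> inv x) \<otimes> x \<oplus> y = \<zero>" using x that by (simp add: l_neg)
  qed
  have mono: "[c] \<in> carrier P" if "c \<in> carrier R - {\<zero>}" for c using that by simp
  have det: "\<exists>c \<in> carrier R - {\<zero>}. X = [c] \<boxtimes> X [^]\<^bsub>P\<^esub> (1::nat)" "\<exists>c \<in> carrier R - {\<zero>}. X = [c] \<boxtimes> X
      [^]\<^bsub>P\<^esub> (Suc 0)"
    by (rule bexI[of _ \<one>]; simp)+
  note [simp] = vanishes_1[unfolded One_nat_def] X0 coeff_add coeff_const_mult deg_le_const
      deg_le_X f g
  show "a = \<zero> \<Longrightarrow> order_basis 1 w1 w2 f g [\<one>] [] [] X w1 (w2 + 1)"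
    using det a by (simp add: order_basis_def)
  show "b = \<zero> \<Longrightarrow> order_basis 1 w1 w2 f g X [] [] [\<one>] (w1 + 1) w2"
    using det b by (simp add: order_basis_def)
  show "order_basis 1 w1 w2 f g X [] [\<ominus> (b \<otimes> inv a)] [\<one>] (w1 + 1) w2"
    if "a \<noteq> \<zero>" "b \<noteq> \<zero>" "w1 \<le> w2"
    using that ab det q[of a b] mono[OF q(1)[of a b]] a b by (simp add: order_basis_def)
  show "order_basis 1 w1 w2 f g [\<one>] [\<ominus> (a \<otimes> inv b)] [] X w1 (w2 + 1)"
    if "a \<noteq> \<zero>" "b \<noteq> \<zero>" "w2 \<le> w1"
    using that ab det q[of b a] mono[OF q(1)[of b a]] a b by (simp add: order_basis_def a_comm)
qed

text \<open>Peels off one power of X at a time. The uniqueness claim needs some basis, but has no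
  multiplication program at hand.\<close>

lemma order_basis_exists:
  assumes "f \<in> carrier P" "g \<in> carrier P" "0 < n"
  shows "\<exists>A1 B1 A2 B2 v1 v2. order_basis n w1 w2 f g A1 B1 A2 B2 v1 v2"
proof -
  have step: "\<exists>A1 B1 A2 B2 v1 v2. order_basis 1 w1 w2 f g A1 B1 A2 B2 v1 v2"
    if f: "f \<in> carrier P" and g: "g \<in> carrier P" for f g w1 w2
  proof -
    consider "coeff f 0 = \<zero>" | "coeff g 0 = \<zero>" | "coeff f 0 \<noteq> \<zero>" "coeff g 0 \<noteq> \<zero>" "w1 \<le> w2"
      | "coeff f 0 \<noteq> \<zero>" "coeff g 0 \<noteq> \<zero>" "w2 \<le> w1" by linarith
    then show ?thesis
      by cases (use order_basis_step[OF f g refl refl] in blast)+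
  qed
  show ?thesis using assms(3,1,2)
  proof (induction n arbitrary: rule: nat_induct_non_zero)
    case 1
    show ?case by (rule step) fact+
  next
    case (Suc n)
    obtain A1 B1 A2 B2 v1 v2 where Q: "order_basis n w1 w2 f g A1 B1 A2 B2 v1 v2"
      using Suc.IH[OF Suc.prems] by blast
    then have "A1 \<in> carrier P" "B1 \<in> carrier P" "A2 \<in> carrier P" "B2 \<in> carrier P"
      by (simp_all add: order_basis_def)
    then have "\<exists>C1 D1 C2 D2 u1 u2. order_basis 1 v1 v2 (shift n (A1 \<boxtimes> f \<boxplus> B1 \<boxtimes> g)) (shift n (A2 \<boxtimes>
        f \<boxplus> B2 \<boxtimes> g)) C1 D1 C2 D2 u1 u2"
      using Suc.prems by (intro step) simp_all
    then obtain C1 D1 C2 D2 u1 u2 where "order_basis 1 v1 v2 (shift n (A1 \<boxtimes> f \<boxplus> B1 \<boxtimes> g)) (shift n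
        (A2 \<boxtimes> f \<boxplus> B2 \<boxtimes> g)) C1 D1 C2 D2 u1 u2"
      by blast
    from order_basis_compose[OF Q Suc.prems this] show ?case unfolding Suc_eq_plus1 by blast
  qed
qed

lemma vanishes_minus: "vanishes n A \<Longrightarrow> vanishes n B \<Longrightarrow> vanishes n (A \<boxminus> B)"
  using vanishes_closed[of n A] vanishes_closed[of n B] by (simp add: vanishes_iff coeff_minus
      minus_eq)

section \<open>The solution as a row of an order basis\<close>

text \<open>
  Cramer's rule: both numerators vanish modulo \<open>X ^ l\<close>, and the determinant is \<open>c X ^ l\<close>.
\<close>

lemma order_basis_combination:
  assumes Q: "order_basis l 0 m [\<ominus> \<one>] S A1 B1 A2 B2 d1 d2"
    and S: "S \<in> carrier P" and F: "F \<in> carrier P" and G: "G \<in> carrier P"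
    and SG: "vanishes l (S \<boxtimes> G \<boxminus> F)"
    and dF: "deg_le F a" and dG: "deg_le G (a - m)"
  obtains c U V where "c \<in> carrier R - {\<zero>}" "U \<in> carrier P" "V \<in> carrier P"
    "[c] \<boxtimes> F = U \<boxtimes> A1 \<boxplus> V \<boxtimes> A2" "[c] \<boxtimes> G = U \<boxtimes> B1 \<boxplus> V \<boxtimes> B2"
    "deg_le U (a - d1)" "deg_le V (a - d2)"
proof -
  have cl: "A1 \<in> carrier P" "B1 \<in> carrier P" "A2 \<in> carrier P" "B2 \<in> carrier P"
    using Q by (simp_all add: order_basis_def)
  have m1: "[\<ominus> \<one>] = \<ominus>\<^bsub>P\<^esub> \<one>\<^bsub>P\<^esub>" using neg_const[of \<one>] by (simp add: oneP)
  define U where "U = shift l (F \<boxtimes> B2 \<boxminus> G \<boxtimes> A2)"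
  define V where "V = shift l (A1 \<boxtimes> G \<boxminus> B1 \<boxtimes> F)"
  have UV: "U \<in> carrier P" "V \<in> carrier P" using cl F G by (simp_all add: U_def V_def)
  have res: "vanishes l (A1 \<boxtimes> (\<ominus>\<^bsub>P\<^esub> \<one>\<^bsub>P\<^esub>) \<boxplus> B1 \<boxtimes> S)" "vanishes l (A2 \<boxtimes> (\<ominus>\<^bsub>P\<^esub> \<one>\<^bsub>P\<^esub>) \<boxplus> B2 \<boxtimes> S)"
    using Q by (simp_all only: order_basis_def m1)
  have "vanishes l (F \<boxtimes> B2 \<boxminus> G \<boxtimes> A2)"
    unfolding P.cramer_residual1[OF F G S cl(3,4)]
    by (intro vanishes_minus vanishes_mult res SG G cl)
  then have U: "F \<boxtimes> B2 \<boxminus> G \<boxtimes> A2 = Xpow l \<boxtimes> U"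
    unfolding U_def using F G cl by (intro vanishes_shift) simp_all
  have "vanishes l (A1 \<boxtimes> G \<boxminus> B1 \<boxtimes> F)"
    unfolding P.cramer_residual2[OF F G S cl(1,2)]
    by (intro vanishes_minus vanishes_mult res SG G cl)
  then have V: "A1 \<boxtimes> G \<boxminus> B1 \<boxtimes> F = Xpow l \<boxtimes> V"
    unfolding V_def using F G cl by (intro vanishes_shift) simp_all
  obtain c where c: "c \<in> carrier R - {\<zero>}" "A1 \<boxtimes> B2 \<boxminus> A2 \<boxtimes> B1 = [c] \<boxtimes> Xpow l"
    using Q by (auto simp: order_basis_def)
  have cP: "[c] \<in> carrier P" using c by simp
  have "Xpow l \<boxtimes> ([c] \<boxtimes> F) = Xpow l \<boxtimes> (U \<boxtimes> A1 \<boxplus> V \<boxtimes> A2)"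
    using P.cramer_sum1[OF F G cl] cP UV cl F unfolding U V c(2) by (simp add: P.r_distr P.m_ac)
  then have 1: "[c] \<boxtimes> F = U \<boxtimes> A1 \<boxplus> V \<boxtimes> A2"
    by (rule Xpow_cancel) (simp_all add: cP UV cl F)
  have "Xpow l \<boxtimes> ([c] \<boxtimes> G) = Xpow l \<boxtimes> (U \<boxtimes> B1 \<boxplus> V \<boxtimes> B2)"
    using P.cramer_sum2[OF F G cl] cP UV cl G unfolding U V c(2) by (simp add: P.r_distr P.m_ac)
  then have 2: "[c] \<boxtimes> G = U \<boxtimes> B1 \<boxplus> V \<boxtimes> B2"
    by (rule Xpow_cancel) (simp_all add: cP UV cl G)
  have d: "deg_le A1 d1" "deg_le B1 (d1 - m)" "deg_le A2 d2" "deg_le B2 (d2 - m)" "d1 + d2 = m +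
      int l"
    using Q by (simp_all add: order_basis_def)
  \<comment> \<open>By \<open>d(5)\<close>, \<open>a - d1 + l\<close> equals
    \<open>a + d2 - m\<close>, which bounds both products in the first numerator; the second one is
    symmetric. Dividing by X^l then removes the \<open>l\<close>.\<close>
  have "deg_le (F \<boxtimes> B2 \<boxminus> G \<boxtimes> A2) (a - d1 + int l)" "deg_le (A1 \<boxtimes> G \<boxminus> B1 \<boxtimes> F) (a - d2 + int l)"
    by (rule deg_le_minus deg_le_mult d dF dG F G cl P.m_closed | use d(5) in linarith)+
  then have "deg_le U (a - d1)" "deg_le V (a - d2)"
    unfolding U V using deg_le_Xpow_mult UV by fastforce+
  with c(1) UV 1 2 show ?thesis by (rule that)
qed

lemma inv_nonzero: "x \<in> carrier R - {\<zero>} \<Longrightarrow> inv x \<in> carrier R - {\<zero>}"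
  using field_Units Units_inv_Units[of x] by blast

text \<open>Up to the unit \<open>c\<close>, the polynomial \<open>U\<close> divides both F and G,
  so coprimality makes it a divisor of one and hence a nonzero constant.\<close>

lemma coprime_factor_const:
  assumes c: "c \<in> carrier R - {\<zero>}" and cl: "U \<in> carrier P" "S \<in> carrier P" "T \<in> carrier P"
      "F \<in> carrier P" "G \<in> carrier P"
    and F: "[c] \<boxtimes> F = U \<boxtimes> S" and G: "[c] \<boxtimes> G = U \<boxtimes> T"
    and coprime: "\<one>\<^bsub>P\<^esub> gcdof\<^bsub>P\<^esub> F G"
  shows "\<exists>k \<in> carrier R - {\<zero>}. F = [k] \<boxtimes> S \<and> G = [k] \<boxtimes> T"
proof -
  have iu: "inv c \<in> carrier R - {\<zero>}" "inv c \<otimes> c = \<one>"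
    using c inv_nonzero[OF c] by (simp_all add: field_Units)
  have ic: "[inv c] \<in> carrier P" "[c] \<in> carrier P" "[inv c] \<boxtimes> [c] = \<one>\<^bsub>P\<^esub>"
    using c iu const_mult_Xpow[of "inv c" c 0 0] by (simp_all add: oneP)
  have H: "H = U \<boxtimes> ([inv c] \<boxtimes> Y)" if "[c] \<boxtimes> H = U \<boxtimes> Y" "H \<in> carrier P" "Y \<in> carrier P" for H Y
  proof -
    have "H = ([inv c] \<boxtimes> [c]) \<boxtimes> H" using that ic by simp
    also have "\<dots> = [inv c] \<boxtimes> ([c] \<boxtimes> H)" using that(2) ic(1,2) by (intro P.m_assoc)
    also have "\<dots> = [inv c] \<boxtimes> (U \<boxtimes> Y)" by (simp only: that(1))
    finally show ?thesis using that ic cl by (simp add: P.m_lcomm)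
  qed
  have "U divides\<^bsub>P\<^esub> F" by (rule dividesI[OF _ H[OF F]]) (use cl ic in simp_all)
  moreover have "U divides\<^bsub>P\<^esub> G" by (rule dividesI[OF _ H[OF G]]) (use cl ic in simp_all)
  ultimately have "U divides\<^bsub>P\<^esub> \<one>\<^bsub>P\<^esub>" using coprime cl by (auto simp: isgcd_def)
  then obtain W where W: "W \<in> carrier P" "\<one>\<^bsub>P\<^esub> = U \<boxtimes> W" by (auto simp: factor_def)
  \<comment> \<open>Needed before degrees are compared, since \<open>[]\<close> has degree 0 as
    well.\<close>
  have "U \<noteq> []" "W \<noteq> []" using W cl P.l_null P.r_null by (auto simp: zeroP oneP)
  moreover have "degree U + degree W = 0"
    using poly_mult_degree_eq[OF carrier_is_subring, of U W] W(1) W(2)[symmetric] cl calculation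
    by (simp add: carrierP_iff oneP multP[symmetric])
  ultimately obtain u where u: "U = [u]" by (cases U) auto
  then have u': "u \<in> carrier R - {\<zero>}" using cl by (auto simp: carrierP_iff polynomial_def)
  have k: "u \<otimes> inv c \<in> carrier R - {\<zero>}" using iu u' by (auto simp: integral_iff)
  have "U \<boxtimes> ([inv c] \<boxtimes> Y) = [u \<otimes> inv c] \<boxtimes> Y" if "Y \<in> carrier P" for Y
    using const_mult_Xpow[OF u' iu(1), of 0 0] cl ic that k by (simp add: u P.m_assoc[symmetric])
  then have "F = [u \<otimes> inv c] \<boxtimes> S \<and> G = [u \<otimes> inv c] \<boxtimes> T" using H[OF F] H[OF G] cl by simp
  then show ?thesis using k by blast
qed

lemma nonzero_div: "x \<in> carrier R - {\<zero>} \<Longrightarrow> y \<in> carrier R - {\<zero>} \<Longrightarrow> x \<otimes> inv y \<in> carrier R - {\<zero>}"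
  using inv_nonzero[of y] by (auto simp: integral_iff)

text \<open>
  If the degrees of the rows differ, the solution is a multiple of the smaller row. If they agree,
  the solution is a combination of both rows with constant coefficients, which is determined up to
  a scalar by the two leading coefficients of the solution being equal; \<open>e1\<close> and \<open>e2\<close> measure by
  how much the rows fail this condition.
\<close>

definition minimal_row ::
  "int \<Rightarrow> 'a list \<Rightarrow> 'a list \<Rightarrow> 'a list \<Rightarrow> 'a list \<Rightarrow> int \<Rightarrow> int \<Rightarrow> 'a list \<times> 'a list" where
  "minimal_row m A1 B1 A2 B2 d1 d2 =
     (if d1 < d2 then (A1, B1) else if d2 < d1 then (A2, B2)
      else let e1 = coeff A1 (nat d1) \<ominus> coeff B1 (nat (d1 - m));
               e2 = coeff A2 (nat d1) \<ominus> coeff B2 (nat (d1 - m))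
       in if e1 = \<zero> then (A1, B1) else if e2 = \<zero> then (A2, B2)
          else ([\<ominus> (e2 \<otimes> inv e1)] \<boxtimes> A1 \<boxplus> A2, [\<ominus> (e2 \<otimes> inv e1)] \<boxtimes> B1 \<boxplus> B2))"

lemma minus_div_nonzero:
  "x \<in> carrier R - {\<zero>} \<Longrightarrow> y \<in> carrier R - {\<zero>} \<Longrightarrow> \<ominus> (x \<otimes> inv y) \<in> carrier R - {\<zero>}"
  using nonzero_div[of x y] by auto

lemma minimal_row_closed:
  assumes "A1 \<in> carrier P" "B1 \<in> carrier P" "A2 \<in> carrier P" "B2 \<in> carrier P"
    and "minimal_row m A1 B1 A2 B2 d1 d2 = (Y, Z)"
  shows "Y \<in> carrier P" "Z \<in> carrier P"
proof -
  define e1 e2 where "e1 = coeff A1 (nat d1) \<ominus> coeff B1 (nat (d1 - m))"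
    and "e2 = coeff A2 (nat d1) \<ominus> coeff B2 (nat (d1 - m))"
  have e: "e1 \<in> carrier R" "e2 \<in> carrier R" using assms by (simp_all add: e1_def e2_def)
  have q: "[\<ominus> (e2 \<otimes> inv e1)] \<in> carrier P" if "e1 \<noteq> \<zero>" "e2 \<noteq> \<zero>"
    using minus_div_nonzero[of e2 e1] e that by simp
  show "Y \<in> carrier P" "Z \<in> carrier P"
    using assms q unfolding minimal_row_def Let_def e1_def[symmetric] e2_def[symmetric]
    by (auto split: if_splits)
qed

text \<open>From \<open>ab\<close> and the determinant follows 2 a <= l + m = d1 + d2. If the row
  degrees differ, the multiplier of the longer row has a negative degree bound and vanishes. If they
  agree, both multipliers are constants \<open>u\<close>, \<open>v\<close>, and comparing top
  coefficients gives u e1 + v e2 = 0, which fixes their ratio.\<close>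

lemma minimal_row_solution:
  assumes Q: "order_basis l 0 m [\<ominus> \<one>] S A1 B1 A2 B2 d1 d2"
    and S: "S \<in> carrier P" and F: "F \<in> carrier P" and G: "G \<in> carrier P"
    and SG: "vanishes l (S \<boxtimes> G \<boxminus> F)"
    and dF: "deg_le F (int a)" "coeff F a = \<one>" and dG: "deg_le G (int b)" "coeff G b = \<one>"
    and ab: "int a - int b = m" "a + b \<le> l"
    and coprime: "\<one>\<^bsub>P\<^esub> gcdof\<^bsub>P\<^esub> F G"
    and row: "minimal_row m A1 B1 A2 B2 d1 d2 = (Y, Z)"
  shows "\<exists>k \<in> carrier R - {\<zero>}. F = [k] \<boxtimes> Y \<and> G = [k] \<boxtimes> Z"
proof -
  have cl: "A1 \<in> carrier P" "B1 \<in> carrier P" "A2 \<in> carrier P" "B2 \<in> carrier P"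
    using Q by (simp_all add: order_basis_def)
  have "int a - m = int b" using ab by simp
  then have dG': "deg_le G (int a - m)" using dG(1) by simp
  obtain c U V where c: "c \<in> carrier R - {\<zero>}" and UV: "U \<in> carrier P" "V \<in> carrier P"
    and eq: "[c] \<boxtimes> F = U \<boxtimes> A1 \<boxplus> V \<boxtimes> A2" "[c] \<boxtimes> G = U \<boxtimes> B1 \<boxplus> V \<boxtimes> B2"
    and dUV: "deg_le U (int a - d1)" "deg_le V (int a - d2)"
    using order_basis_combination[OF Q S F G SG dF(1) dG'] by metis
  have d: "deg_le A1 d1" "deg_le B1 (d1 - m)" "deg_le A2 d2" "deg_le B2 (d2 - m)" "d1 + d2 = m +
      int l"
    using Q by (simp_all add: order_basis_def)
  have res1: ?thesis if "V = []" "(Y, Z) = (A1, B1)"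
    using coprime_factor_const[OF c UV(1) cl(1,2) F G _ _ coprime] that eq cl UV by simp
  have res2: ?thesis if "U = []" "(Y, Z) = (A2, B2)"
    using coprime_factor_const[OF c UV(2) cl(3,4) F G _ _ coprime] that eq cl UV by simp
  consider "d1 < d2" | "d2 < d1" | "d1 = d2" by linarith
  then show ?thesis
  proof cases
    case 1
    then have "V = []" using ab d(5) by (intro deg_le_neg[OF UV(2) dUV(2)]) linarith
    then show ?thesis using 1 row by (intro res1) (auto simp: minimal_row_def)
  next
    case 2
    then have "U = []" using ab d(5) by (intro deg_le_neg[OF UV(1) dUV(1)]) linarith
    then show ?thesis using 2 row by (intro res2) (auto simp: minimal_row_def)
  next
    case 3
    define N M where "N = nat d1" and "M = nat (d1 - m)"
    \<comment> \<open>In a tie \<open>d1\<close> is (l + m) / 2 and \<open>d1 - m\<close> is (l - m)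
      / 2. Neither is negative, so \<open>nat\<close> loses nothing, and \<open>N + M\<close> is the
      exponent of the determinant.\<close>
    have NM: "d1 = int N" "d1 - m = int M" "a \<le> N" "b \<le> M" "a = N \<longleftrightarrow> b = M" "l = N + M"
      using 3 d(5) ab by (auto simp: N_def M_def)
    have d0: "deg_le U (int 0)" "deg_le V (int 0)"
      using dUV 3 NM by (auto elim!: deg_le_mono)
    define u v where "u = coeff U 0" and "v = coeff V 0"
    define e1 e2 where "e1 = coeff A1 N \<ominus> coeff B1 M" and "e2 = coeff A2 N \<ominus> coeff B2 M"
    have e: "e1 \<in> carrier R" "e2 \<in> carrier R" "u \<in> carrier R" "v \<in> carrier R"
      using cl UV by (simp_all add: e1_def e2_def u_def v_def)
    have dd: "deg_le A1 (int N)" "deg_le B1 (int M)" "deg_le A2 (int N)" "deg_le B2 (int M)"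
      using d 3 NM by simp_all
    have row': "(Y, Z) = (if e1 = \<zero> then (A1, B1) else if e2 = \<zero> then (A2, B2)
          else ([\<ominus> (e2 \<otimes> inv e1)] \<boxtimes> A1 \<boxplus> A2, [\<ominus> (e2 \<otimes> inv e1)] \<boxtimes> B1 \<boxplus> B2))"
      using row[symmetric] 3 by (simp add: minimal_row_def e1_def e2_def N_def M_def Let_def)
    \<comment> \<open>Either both top degrees are attained and both coefficients are one, or both
      degrees fall short and both coefficients are zero.\<close>
    have FG: "coeff F N = coeff G M"
    proof (cases "a = N")
      case True
      then show ?thesis using NM dF dG by simp
    next
      case False
      then show ?thesis using NM dF dG unfolding deg_le_def
        by (metis le_neq_implies_less of_nat_less_iff)
    qed
    have t: "coeff (U \<boxtimes> A) i = u \<otimes> coeff A i" "coeff (V \<boxtimes> A) i = v \<otimes> coeff A i"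
      if "A \<in> carrier P" "deg_le A (int i)" for A i
      using coeff_mult_top[OF d0(1) that(2) UV(1) that(1)] coeff_mult_top[OF d0(2) that(2) UV(2)
          that(1)]
      by (simp_all add: u_def v_def)
    have "u \<otimes> coeff A1 N \<oplus> v \<otimes> coeff A2 N = coeff ([c] \<boxtimes> F) N"
      unfolding eq using UV cl dd by (simp add: coeff_add t)
    also have "\<dots> = coeff ([c] \<boxtimes> G) M"
      using c F G FG by (simp add: coeff_const_mult)
    also have "\<dots> = u \<otimes> coeff B1 M \<oplus> v \<otimes> coeff B2 M"
      unfolding eq using UV cl dd by (simp add: coeff_add t)
    finally have top: "u \<otimes> coeff A1 N \<oplus> v \<otimes> coeff A2 N = u \<otimes> coeff B1 M \<oplus> v \<otimes> coeff B2 M" .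
    have "u \<otimes> e1 \<oplus> v \<otimes> e2 = (u \<otimes> coeff A1 N \<oplus> v \<otimes> coeff A2 N) \<ominus> (u \<otimes> coeff B1 M \<oplus> v \<otimes> coeff B2 M)"
      unfolding e1_def e2_def using coeff_closed[OF cl(1), of N] coeff_closed[OF cl(2), of M]
        coeff_closed[OF cl(3), of N] coeff_closed[OF cl(4), of M] e(3,4)
      by algebra
    then have uv: "u \<otimes> e1 \<oplus> v \<otimes> e2 = \<zero>" unfolding top using cl e by (simp add: r_neg minus_eq)
    have const: "A = []" if "A \<in> carrier P" "deg_le A (int 0)" "coeff A 0 = \<zero>" for A
      using that P.zero_closed by (intro poly_eqI) (auto simp: deg_le_def, metis neq0_conv)
    \<comment> \<open>If both were zero, the two columns of top coefficients would coincide, and the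
      coefficient of X^l in the determinant would vanish.\<close>
    have nz: "\<not> (e1 = \<zero> \<and> e2 = \<zero>)"
    proof
      assume "e1 = \<zero> \<and> e2 = \<zero>"
      then have *: "coeff B1 M = coeff A1 N" "coeff B2 M = coeff A2 N"
        using cl by (simp_all add: e1_def e2_def)
      obtain c where c: "c \<in> carrier R - {\<zero>}" "A1 \<boxtimes> B2 \<boxminus> A2 \<boxtimes> B1 = [c] \<boxtimes> Xpow l"
        using Q by (auto simp: order_basis_def)
      have "coeff (A1 \<boxtimes> B2 \<boxminus> A2 \<boxtimes> B1) l = \<zero>"
        using cl dd by (simp add: NM(6) coeff_minus coeff_mult_top * m_comm minus_eq r_neg)
      moreover have "coeff ([c] \<boxtimes> Xpow l) l = c"
        using c coeff_Xpow_mult[of "\<one>\<^bsub>P\<^esub>" l l] by (simp add: coeff_const_mult oneP)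
      ultimately show False using c by simp
    qed
    show ?thesis
    proof (cases "e1 = \<zero>")
      case True
      then have "v = \<zero>" using uv nz e by (auto simp: integral_iff)
      then have "V = []" using const[OF UV(2) d0(2)] by (simp add: v_def)
      then show ?thesis using True row' by (intro res1) simp_all
    next
      case e1: False
      show ?thesis
      proof (cases "e2 = \<zero>")
        case True
        then have "u = \<zero>" using uv e1 e by (auto simp: integral_iff)
        then have "U = []" using const[OF UV(1) d0(1)] by (simp add: u_def)
        then show ?thesis using True e1 row' by (intro res2) simp_all
      next
        case e2: False
        define q where "q = \<ominus> (e2 \<otimes> inv e1)"
        have q: "q \<in> carrier R - {\<zero>}" using nonzero_div[of e2 e1] e1 e2 e by (auto simp: q_def)
        have i: "inv e1 \<in> carrier R" "e1 \<otimes> inv e1 = \<one>" using e1 e by (auto simp: field_Units)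
        \<comment> \<open>Solving the linear condition for \<open>u\<close> makes \<open>U\<close> a
          constant multiple of \<open>V\<close>; then \<open>V\<close> factors out of both
          combinations, leaving multiples of a single row.\<close>
        have "u = (u \<otimes> e1 \<oplus> v \<otimes> e2) \<otimes> inv e1 \<ominus> v \<otimes> (e2 \<otimes> inv e1)"
          using i e by (simp add: l_distr m_assoc minus_eq r_neg a_assoc)
        also have "\<dots> = \<zero> \<otimes> inv e1 \<ominus> v \<otimes> (e2 \<otimes> inv e1)" by (simp only: uv)
        also have "\<dots> = q \<otimes> v" using i e by (simp add: q_def minus_eq l_minus r_minus m_comm)
        finally have uq: "u = q \<otimes> v" .
        have Uq: "U = [q] \<boxtimes> V"
        proof (rule poly_eqI)
          fix j show "coeff U j = coeff ([q] \<boxtimes> V) j"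
            using q UV uq d0 by (cases "j = 0") (auto simp: coeff_const_mult u_def v_def deg_le_def)
        qed (use UV q in auto)
        have qP: "[q] \<in> carrier P" using q by simp
        have "[c] \<boxtimes> F = V \<boxtimes> ([q] \<boxtimes> A1 \<boxplus> A2)" "[c] \<boxtimes> G = V \<boxtimes> ([q] \<boxtimes> B1 \<boxplus> B2)"
          unfolding eq Uq using qP UV cl by (simp_all add: P.r_distr P.m_ac)
        then show ?thesis
          using coprime_factor_const[OF c UV(2) _ _ F G _ _ coprime] qP cl row' e1 e2
          by (simp add: q_def)
      qed
    qed
  qed
qed

text \<open>The unknown scalar \<open>k\<close> is forced to be the inverse of the leading
  coefficient of \<open>Y\<close>, so the final formula for \<open>F\<close> involves
  \<open>Y\<close> alone.\<close>

lemma monic_multiple: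
  assumes "monic_poly R F" "F = [k] \<boxtimes> Y" "k \<in> carrier R - {\<zero>}" "Y \<in> carrier P"
  shows "Y \<noteq> []" "hd Y \<in> carrier R - {\<zero>}" "F = [inv (hd Y)] \<boxtimes> Y"
proof -
  have F: "F = map (\<lambda>y. k \<otimes> y) Y"
    using assms poly_mult_const(1)[OF carrier_is_subring, of Y k] by (simp add: multP carrierP_iff)
  then show Y: "Y \<noteq> []" using assms by (auto simp: monic_poly_def)
  then show h: "hd Y \<in> carrier R - {\<zero>}" using assms by (auto simp: carrierP_iff polynomial_def)
  have "k \<otimes> hd Y = \<one>" using F Y assms(1) by (simp add: monic_poly_def hd_map)
  then have "inv (hd Y) = k" using h assms(3) by (auto intro!: comm_inv_char simp: m_comm)
  then show "F = [inv (hd Y)] \<boxtimes> Y" using assms by simp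
qed

lemma eval_zero: "set G \<subseteq> carrier R \<Longrightarrow> eval G \<zero> = coeff G 0"
  by (induction G) (auto simp: nat_pow_zero eval_in_carrier)

section \<open>Fractions modulo a power of the variable\<close>

text \<open>The lowest nonzero coefficient of \<open>D\<close> would reappear in the product,
  multiplied by the nonzero G(0).\<close>

lemma vanishes_mult_cancel:
  assumes G: "G \<in> carrier P" "coeff G 0 \<noteq> \<zero>" and D: "D \<in> carrier P" and v: "vanishes n (D \<boxtimes> G)"
  shows "vanishes n D"
  using v
proof (induction n)
  case 0
  then show ?case using D by (simp add: vanishes_iff)
next
  case (Suc n)
  then have "vanishes n D" using D G by (auto simp: vanishes_iff)
  then obtain E where E: "E \<in> carrier P" "D = Xpow n \<boxtimes> E" by (auto simp: vanishes_def)
  have "D \<boxtimes> G = Xpow n \<boxtimes> (E \<boxtimes> G)" using E G by (simp add: P.m_assoc)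
  moreover have "coeff (D \<boxtimes> G) n = \<zero>" using Suc.prems D G by (simp add: vanishes_iff)
  ultimately have "coeff (E \<boxtimes> G) 0 = \<zero>" using E G by (simp add: coeff_Xpow_mult)
  moreover have "coeff (E \<boxtimes> G) 0 = coeff E 0 \<otimes> coeff G 0" using E G by (simp add: coeff_mult)
  ultimately have "coeff E 0 = \<zero>" using E G by (auto simp: integral_iff)
  then show ?case using E D by (auto simp: vanishes_iff coeff_Xpow_mult less_Suc_eq)
qed

text \<open>Power series division, one coefficient at a time: the error \<open>t\<close> at X^n is
  removed by subtracting t / G(0) times X^n from the quotient.\<close>

lemma quotient_exists:
  assumes F: "F \<in> carrier P" and G: "G \<in> carrier P" "coeff G 0 \<noteq> \<zero>"
  shows "\<exists>S \<in> carrier P. deg_le S (int n - 1) \<and> vanishes n (S \<boxtimes> G \<boxminus> F)"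
proof (induction n)
  case 0
  show ?case using F G by (intro bexI[of _ "[]"]) (auto simp: vanishes_iff)
next
  case (Suc n)
  then obtain S where S: "S \<in> carrier P" "deg_le S (int n - 1)" "vanishes n (S \<boxtimes> G \<boxminus> F)" by auto
  define t where "t = coeff (S \<boxtimes> G \<boxminus> F) n"
  have t: "t \<in> carrier R" using S F G by (simp add: t_def)
  show ?case
  proof (cases "t = \<zero>")
    case True
    then have "vanishes (Suc n) (S \<boxtimes> G \<boxminus> F)"
      using S F G by (auto simp: vanishes_iff less_Suc_eq t_def)
    moreover have "deg_le S (int (Suc n) - 1)" using S(2) by (rule deg_le_mono) simp
    ultimately show ?thesis using S by auto
  next
    case False
    define c where "c = t \<otimes> inv (coeff G 0)"
    have c: "c \<in> carrier R - {\<zero>}" unfolding c_def using False t G by (intro nonzero_div) auto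
    have cg: "c \<otimes> coeff G 0 = t"
      using G t by (simp add: c_def m_assoc field_Units)
    let ?S = "S \<boxminus> Xpow n \<boxtimes> [c]"
    have cP: "[c] \<in> carrier P" using c by simp
    have "?S \<boxtimes> G \<boxminus> F = (S \<boxtimes> G \<boxminus> F) \<boxminus> Xpow n \<boxtimes> ([c] \<boxtimes> G)"
      using S F G cP by (intro P.residual_update) simp_all
    moreover have "vanishes (Suc n) (D \<boxminus> Xpow n \<boxtimes> ([c] \<boxtimes> G))"
      if "D \<in> carrier P" "vanishes n D" "coeff D n = t" for D
      using that G c cP t cg
      by (auto simp: vanishes_iff less_Suc_eq coeff_minus coeff_Xpow_mult coeff_const_mult
          minus_eq r_neg)
    then have "vanishes (Suc n) ((S \<boxtimes> G \<boxminus> F) \<boxminus> Xpow n \<boxtimes> ([c] \<boxtimes> G))"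
      using S F G by (simp add: t_def)
    ultimately have "vanishes (Suc n) (?S \<boxtimes> G \<boxminus> F)" by simp
    moreover have "deg_le ?S (int n)"
    proof (rule deg_le_minus)
      show "deg_le S (int n)" using S(2) by (rule deg_le_mono) simp
      show "deg_le (Xpow n \<boxtimes> [c]) (int n)" using cP
        by (auto simp: deg_le_def coeff_Xpow_mult)
    qed (use S cP in auto)
    ultimately show ?thesis using S cP by (intro bexI[of _ ?S]) auto
  qed
qed

lemma vanishes_iff_pdivides:
  "A \<in> carrier P \<Longrightarrow> Xpow n pdivides A \<longleftrightarrow> vanishes n A"
  by (auto simp: pdivides_def vanishes_def factor_def P_def)

text \<open>\<open>frac_mod\<close> is a definite description, so its congruence becomes available
  only through unique existence: division gives existence, and cancelling G modulo X^l gives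
  uniqueness.\<close>

lemma frac_mod_vanishes:
  assumes F: "F \<in> carrier P" and G: "G \<in> carrier P" "eval G \<zero> \<noteq> \<zero>" and l: "0 < l"
  shows "vanishes l (frac_mod R F G l \<boxtimes> G \<boxminus> F)"
proof -
  \<comment> \<open>G(0) is the constant coefficient. The degree translation that follows would fail
    at \<open>l = 0\<close>, because \<open>[]\<close> has degree 0.\<close>
  have G0: "coeff G 0 \<noteq> \<zero>" using G eval_zero[of G] by (simp add: set_carrierP)
  have deg: "degree S < l \<longleftrightarrow> deg_le S (int l - 1)" if "S \<in> carrier P" for S
    using deg_le_length[OF that, of "l - 1"] l by (auto simp: of_nat_diff)
  let ?sol = "\<lambda>S. S \<in> carrier (poly_ring R) \<and> degree S < l \<and> X [^]\<^bsub>poly_ring R\<^esub> l pdivides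
     (S \<otimes>\<^bsub>poly_ring R\<^esub> G \<ominus>\<^bsub>poly_ring R\<^esub> F)"
  have sol: "?sol S \<longleftrightarrow> S \<in> carrier P \<and> deg_le S (int l - 1) \<and> vanishes l (S \<boxtimes> G \<boxminus> F)" for S
    unfolding P_def[symmetric] using F G deg vanishes_iff_pdivides[of "S \<boxtimes> G \<boxminus> F" l] by auto
  have "\<exists>!S. ?sol S" unfolding sol
  proof (rule ex_ex1I)
    show "\<exists>S. S \<in> carrier P \<and> deg_le S (int l - 1) \<and> vanishes l (S \<boxtimes> G \<boxminus> F)"
      using quotient_exists[OF F G(1) G0] by blast
  next
    fix S T
    assume S': "S \<in> carrier P \<and> deg_le S (int l - 1) \<and> vanishes l (S \<boxtimes> G \<boxminus> F)"
      and T': "T \<in> carrier P \<and> deg_le T (int l - 1) \<and> vanishes l (T \<boxtimes> G \<boxminus> F)"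
    note S = S'[THEN conjunct1] S' and T = T'[THEN conjunct1] T'
    have "(S \<boxminus> T) \<boxtimes> G = (S \<boxtimes> G \<boxminus> F) \<boxminus> (T \<boxtimes> G \<boxminus> F)"
      using S T F G by (intro P.residual_diff) simp_all
    then have "vanishes l ((S \<boxminus> T) \<boxtimes> G)" using S T by (simp add: vanishes_minus)
    then have v: "vanishes l (S \<boxminus> T)" using vanishes_mult_cancel[OF G(1) G0] S T by simp
    show "S = T"
    proof (rule poly_eqI)
      fix i show "coeff S i = coeff T i"
        using v S T by (cases "i < l") (auto simp: vanishes_iff coeff_minus deg_le_def)
    qed (use S T in auto)
  qed
  then have "?sol (frac_mod R F G l)" unfolding frac_mod_def by (rule theI')
  then show ?thesis unfolding sol by simp
qed

lemma monic_degree: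
  assumes "monic_poly R F"
  shows "F \<in> carrier P" "deg_le F (int (degree F))" "coeff F (degree F) = \<one>"
  using assms deg_le_degree[of F] lead_coeff_simp[of F] by (simp_all add: monic_poly_def P_def)

text \<open>The row \<open>(Y, Z)\<close> comes from \<open>S\<close>, \<open>l\<close> and
  \<open>m\<close> without reference to F and G. Hence one fixed basis yields uniqueness, and a
  computed basis yields the algorithm.\<close>

theorem reconstruction:
  assumes F: "monic_poly R F" and G: "monic_poly R G" and coprime: "\<one>\<^bsub>P\<^esub> gcdof\<^bsub>P\<^esub> F G"
    and G0: "eval G \<zero> \<noteq> \<zero>" and l: "0 < l" and deg: "degree F + degree G \<le> l"
    and m: "int (degree F) - int (degree G) = m"
    and S: "S \<in> carrier P" "frac_mod R F G l = S"
    and Q: "order_basis l 0 m [\<ominus> \<one>] S A1 B1 A2 B2 d1 d2"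
    and row: "minimal_row m A1 B1 A2 B2 d1 d2 = (Y, Z)"
  shows "Y \<noteq> []" "Z \<noteq> []" "hd Y \<in> carrier R - {\<zero>}" "hd Z \<in> carrier R - {\<zero>}"
    "F = [inv (hd Y)] \<boxtimes> Y" "G = [inv (hd Z)] \<boxtimes> Z"
proof -
  note F' = monic_degree[OF F] and G' = monic_degree[OF G]
  have "vanishes l (S \<boxtimes> G \<boxminus> F)" using frac_mod_vanishes[OF F'(1) G'(1) G0 l] S by simp
  then obtain k where k: "k \<in> carrier R - {\<zero>}" "F = [k] \<boxtimes> Y" "G = [k] \<boxtimes> Z"
    using minimal_row_solution[OF Q S(1) F'(1) G'(1) _ F'(2,3) G'(2,3) m deg coprime row] by blast
  have YZ: "Y \<in> carrier P" "Z \<in> carrier P"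
    using minimal_row_closed[OF _ _ _ _ row] Q by (simp_all add: order_basis_def)
  show "Y \<noteq> []" "hd Y \<in> carrier R - {\<zero>}" "F = [inv (hd Y)] \<boxtimes> Y"
    using monic_multiple[OF F k(2,1) YZ(1)] by auto
  show "Z \<noteq> []" "hd Z \<in> carrier R - {\<zero>}" "G = [inv (hd Z)] \<boxtimes> Z"
    using monic_multiple[OF G k(3,1) YZ(2)] by auto
qed

end

section \<open>Evaluating programs\<close>

text \<open>Programs may diverge, so evaluation is not a recursion on terms; it is read off from
  \<open>exec\<close>, with \<open>None\<close> for the absence of a derivation. Determinism makes
  the choice harmless, and the resulting equations let the simplifier run programs and add up
  costs.\<close>

definition ev :: "('a, 'b) ring_scheme \<Rightarrow> prog \<Rightarrow> 'a val list \<Rightarrow> tm \<Rightarrow> ('a val \<times> nat) option" where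
  "ev K P \<rho> t = (if \<exists>r. exec K P \<rho> t (fst r) (snd r)
     then Some (SOME r. exec K P \<rho> t (fst r) (snd r)) else None)"

lemma ev_eq_Some_iff: "ev K P \<rho> t = Some (v, c) \<longleftrightarrow> exec K P \<rho> t v c"
proof
  assume "ev K P \<rho> t = Some (v, c)"
  then have "\<exists>r. exec K P \<rho> t (fst r) (snd r)" and eq: "(SOME r. exec K P \<rho> t (fst r) (snd r)) =
      (v, c)"
    by (auto simp: ev_def split: if_splits)
  from someI_ex[OF this(1)] show "exec K P \<rho> t v c" unfolding eq by simp
next
  assume e: "exec K P \<rho> t v c"
  have "(SOME r. exec K P \<rho> t (fst r) (snd r)) = (v, c)"
  proof (rule some_equality)
    show "exec K P \<rho> t (fst (v, c)) (snd (v, c))" using e by simp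
    show "r = (v, c)" if "exec K P \<rho> t (fst r) (snd r)" for r
      using exec_deterministic[OF e that] by (cases r) simp
  qed
  moreover have "\<exists>r. exec K P \<rho> t (fst r) (snd r)" using e by (intro exI[of _ "(v, c)"]) simp
  ultimately show "ev K P \<rho> t = Some (v, c)" unfolding ev_def by simp
qed

text \<open>Evaluation of a call stops here, and function bodies are substituted explicitly;
  otherwise rewriting would unfold recursive functions without end.\<close>

definition app :: "('a, 'b) ring_scheme \<Rightarrow> prog \<Rightarrow> nat \<Rightarrow> 'a val \<Rightarrow> ('a val \<times> nat) option" where
  "app K P f u = (if f < length P then ev K P [u] (P ! f) else None)"

definition obind :: "('a val \<times> nat) option \<Rightarrow> ('a val \<Rightarrow> ('a val \<times> nat) option) \<Rightarrow> ('a val \<times> nat)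
    option" where
  "obind x f = Option.bind x (\<lambda>(u, c). Option.bind (f u) (\<lambda>(v, d). Some (v, c + d)))"

lemma obind_Some [simp]: "obind (Some (u, c)) f = map_option (\<lambda>(v, d). (v, c + d)) (f u)"
  by (cases "f u") (auto simp: obind_def)

definition as_int :: "'a val \<Rightarrow> (int \<Rightarrow> 'b option) \<Rightarrow> 'b option" where
  "as_int v g = (case v of VInt k \<Rightarrow> g k | _ \<Rightarrow> None)"

definition as_fld :: "'a val \<Rightarrow> ('a \<Rightarrow> 'b option) \<Rightarrow> 'b option" where
  "as_fld v g = (case v of VFld k \<Rightarrow> g k | _ \<Rightarrow> None)"

lemma as_int_fld [simp]: "as_int (VInt k) g = g k" "as_fld (VFld x) h = h x"
  by (simp_all add: as_int_def as_fld_def)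

lemma option_pair_eqI: "(\<And>v c. x = Some (v, c) \<longleftrightarrow> y = Some (v, c)) \<Longrightarrow> x = y"
  by (cases x; cases y) auto

inductive_simps exec_iffs:
  "exec K P \<rho> (Var i) v c"
  "exec K P \<rho> (IntC k) v c"
  "exec K P \<rho> (IntOp h s t) v c"
  "exec K P \<rho> (FldC t) v c"
  "exec K P \<rho> (FldOp g s t) v c"
  "exec K P \<rho> tm.Nil v c"
  "exec K P \<rho> (Pair s t) v c"
  "exec K P \<rho> (LetIn s t) v c"
  "exec K P \<rho> (IfPos r s t) v c"
  "exec K P \<rho> (IfZero r s t) v c"
  "exec K P \<rho> (CaseList r s t) v c"
  "exec K P \<rho> (Call f t) v c"

lemma ev_Var: "ev K P \<rho> (Var i) = (if i < length \<rho> then Some (\<rho> ! i, 0) else None)"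
  by (rule option_pair_eqI; auto simp: ev_eq_Some_iff exec_iffs)

lemma ev_IntC: "ev K P \<rho> (IntC k) = Some (VInt k, 0)"
  by (rule option_pair_eqI; auto simp: ev_eq_Some_iff exec_iffs)

lemma ev_Nil: "ev K P \<rho> tm.Nil = Some (VNil, 0)"
  by (rule option_pair_eqI; auto simp: ev_eq_Some_iff exec_iffs)

lemma ev_IntOp: "ev K P \<rho> (IntOp h s t) = obind (ev K P \<rho> s) (\<lambda>u. obind (ev K P \<rho> t)
     (\<lambda>v. as_int u (\<lambda>i. as_int v (\<lambda>j. Some (VInt (int_op_sem h i j), 0)))))"
  by (rule option_pair_eqI, subst ev_eq_Some_iff, simp only: exec_iffs, simp only:
      ev_eq_Some_iff[symmetric])
    (cases "ev K P \<rho> s"; cases "ev K P \<rho> t";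
      auto simp: obind_def bind_eq_Some_conv as_int_def as_fld_def app_def split: val.splits
          if_splits)

lemma ev_FldC: "ev K P \<rho> (FldC t) = obind (ev K P \<rho> t)
     (\<lambda>v. as_int v (\<lambda>k. Some (VFld ([k] \<cdot>\<^bsub>K\<^esub> \<one>\<^bsub>K\<^esub>), 0)))"
  by (rule option_pair_eqI, subst ev_eq_Some_iff, simp only: exec_iffs, simp only:
      ev_eq_Some_iff[symmetric])
    (cases "ev K P \<rho> t";
      auto simp: obind_def bind_eq_Some_conv as_int_def as_fld_def app_def split: val.splits
          if_splits)

lemma ev_FldOp: "ev K P \<rho> (FldOp g s t) = obind (ev K P \<rho> s) (\<lambda>u. obind (ev K P \<rho> t)
     (\<lambda>v. as_fld u (\<lambda>x. as_fld v (\<lambda>y.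
        if g = FDiv \<longrightarrow> y \<noteq> \<zero>\<^bsub>K\<^esub> then Some (VFld (fld_op_sem K g x y), 1) else None))))"
  by (rule option_pair_eqI, subst ev_eq_Some_iff, simp only: exec_iffs, simp only:
      ev_eq_Some_iff[symmetric])
    (cases "ev K P \<rho> s"; cases "ev K P \<rho> t";
      auto simp: obind_def bind_eq_Some_conv as_int_def as_fld_def app_def split: val.splits
          if_splits)

lemma ev_Pair: "ev K P \<rho> (Pair s t) = obind (ev K P \<rho> s) (\<lambda>u. obind (ev K P \<rho> t) (\<lambda>v. Some (VPair
    u v, 0)))"
  by (rule option_pair_eqI, subst ev_eq_Some_iff, simp only: exec_iffs, simp only:
      ev_eq_Some_iff[symmetric])
    (cases "ev K P \<rho> s"; cases "ev K P \<rho> t";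
      auto simp: obind_def bind_eq_Some_conv as_int_def as_fld_def app_def split: val.splits
          if_splits)

lemma ev_LetIn: "ev K P \<rho> (LetIn s t) = obind (ev K P \<rho> s) (\<lambda>u. ev K P (u # \<rho>) t)"
  by (rule option_pair_eqI, subst ev_eq_Some_iff, simp only: exec_iffs, simp only:
      ev_eq_Some_iff[symmetric])
    (cases "ev K P \<rho> s";
      auto simp: obind_def bind_eq_Some_conv as_int_def as_fld_def app_def split: val.splits
          if_splits)

lemma ev_IfPos: "ev K P \<rho> (IfPos r s t) = obind (ev K P \<rho> r)
     (\<lambda>u. as_int u (\<lambda>i. if 0 < i then ev K P \<rho> s else ev K P \<rho> t))"
  by (rule option_pair_eqI, subst ev_eq_Some_iff, simp only: exec_iffs, simp only:
      ev_eq_Some_iff[symmetric])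
    (cases "ev K P \<rho> r"; cases "ev K P \<rho> s"; cases "ev K P \<rho> t";
      auto simp: obind_def bind_eq_Some_conv as_int_def as_fld_def app_def split: val.splits
          if_splits)

text \<open>The dummy binding of \<open>Some (u, 1)\<close> charges the zero test.\<close>

lemma ev_IfZero: "ev K P \<rho> (IfZero r s t) = obind (ev K P \<rho> r)
     (\<lambda>u. as_fld u (\<lambda>x. obind (Some (u, 1)) (\<lambda>_. if x = \<zero>\<^bsub>K\<^esub> then ev K P \<rho> s else ev K P \<rho> t)))"
  by (rule option_pair_eqI, subst ev_eq_Some_iff, simp only: exec_iffs, simp only:
      ev_eq_Some_iff[symmetric])
    (cases "ev K P \<rho> r"; cases "ev K P \<rho> s"; cases "ev K P \<rho> t";
      auto simp: obind_def bind_eq_Some_conv as_int_def as_fld_def app_def split: val.splits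
          if_splits)

lemma ev_CaseList: "ev K P \<rho> (CaseList r s t) = obind (ev K P \<rho> r)
     (\<lambda>u. case u of VNil \<Rightarrow> ev K P \<rho> s | VPair a b \<Rightarrow> ev K P (a # b # \<rho>) t | _ \<Rightarrow> None)"
  by (rule option_pair_eqI, subst ev_eq_Some_iff, simp only: exec_iffs, simp only:
      ev_eq_Some_iff[symmetric])
    (cases "ev K P \<rho> r";
      auto simp: obind_def bind_eq_Some_conv as_int_def as_fld_def app_def split: val.splits
          if_splits)

lemma ev_Call: "ev K P \<rho> (Call f t) = obind (ev K P \<rho> t) (app K P f)"
  by (rule option_pair_eqI, subst ev_eq_Some_iff, simp only: exec_iffs, simp only:
      ev_eq_Some_iff[symmetric])
    (cases "ev K P \<rho> t";
      auto simp: obind_def bind_eq_Some_conv as_int_def as_fld_def app_def split: val.splits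
          if_splits)

section \<open>The reconstruction program\<close>

fun relabel :: "nat \<Rightarrow> tm \<Rightarrow> tm" where
  "relabel k (Var i) = Var i"
| "relabel k (IntC i) = IntC i"
| "relabel k (IntOp h s t) = IntOp h (relabel k s) (relabel k t)"
| "relabel k (FldC t) = FldC (relabel k t)"
| "relabel k (FldOp g s t) = FldOp g (relabel k s) (relabel k t)"
| "relabel k tm.Nil = tm.Nil"
| "relabel k (Pair s t) = Pair (relabel k s) (relabel k t)"
| "relabel k (LetIn s t) = LetIn (relabel k s) (relabel k t)"
| "relabel k (IfPos r s t) = IfPos (relabel k r) (relabel k s) (relabel k t)"
| "relabel k (IfZero r s t) = IfZero (relabel k r) (relabel k s) (relabel k t)"
| "relabel k (CaseList r s t) = CaseList (relabel k r) (relabel k s) (relabel k t)"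
| "relabel k (Call f t) = Call (f + k) (relabel k t)"

text \<open>Call targets are absolute indices, so placing \<open>M\<close> behind \<open>Q\<close>
  moves each of them by \<open>length Q\<close>.\<close>

lemma exec_relabel:
  assumes "exec K M \<rho> t v c"
  shows "exec K (Q @ map (relabel (length Q)) M) \<rho> (relabel (length Q) t) v c"
  using assms
proof induction
  case (IfPos \<rho> r i c s t v d)
  then show ?case by (auto intro!: exec.IfPos simp: if_distrib cong: if_cong)
next
  case (IfZero \<rho> r x c s t v d)
  then have "exec K (Q @ map (relabel (length Q)) M) \<rho>
      (if x = \<zero>\<^bsub>K\<^esub> then relabel (length Q) s else relabel (length Q) t) v d"
    by (simp add: if_distrib)
  from exec.IfZero[OF IfZero.IH(1) this] show ?case by simp
next
  case (Call \<rho> t u c f v d)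
  then have "exec K (Q @ map (relabel (length Q)) M) [u] ((Q @ map (relabel (length Q)) M) ! (f +
      length Q)) v d"
    by (simp add: nth_append)
  with Call.IH(1) Call.hyps show ?case by (auto intro: exec.Call)
next
  case (FldOp \<rho> s x c t y d f)
  from exec.FldOp[OF FldOp.IH FldOp.hyps(3)] show ?case by simp
qed (auto intro: exec.intros)

text \<open>List cells double as tuples, so a projection is a case distinction with a dummy branch
  for the empty list.\<close>

definition Fst :: "tm \<Rightarrow> tm" where "Fst t = CaseList t tm.Nil (Var 0)"
definition Snd :: "tm \<Rightarrow> tm" where "Snd t = CaseList t tm.Nil (Var 1)"

lemma ev_Fst: "ev K P \<rho> (Fst t) = obind (ev K P \<rho> t)
     (\<lambda>u. case u of VNil \<Rightarrow> Some (VNil, 0) | VPair a b \<Rightarrow> Some (a, 0) | _ \<Rightarrow> None)"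
  and ev_Snd: "ev K P \<rho> (Snd t) = obind (ev K P \<rho> t)
     (\<lambda>u. case u of VNil \<Rightarrow> Some (VNil, 0) | VPair a b \<Rightarrow> Some (b, 0) | _ \<Rightarrow> None)"
  by (simp_all add: Fst_def Snd_def ev_CaseList ev_Var ev_Nil cong: val.case_cong)

lemmas ev_simps = ev_Var ev_IntC ev_Nil ev_IntOp ev_FldC ev_FldOp ev_Pair ev_LetIn ev_IfPos
    ev_IfZero
  ev_CaseList ev_Call ev_Fst ev_Snd

text \<open>
  The continuation of a binding is only unfolded once its argument is a value; otherwise the
  simplifier would evaluate it symbolically on an unknown.
\<close>

lemma weak_congs [cong]:
  "x = y \<Longrightarrow> obind x f = obind y f"
  "u = v \<Longrightarrow> as_int u g = as_int v g"
  "u = v \<Longrightarrow> as_fld u h = as_fld v h"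
  by simp_all

abbreviation "Snd2 t \<equiv> Snd (Snd t)"
abbreviation "Snd3 t \<equiv> Snd (Snd2 t)"
abbreviation "Snd4 t \<equiv> Snd (Snd3 t)"
abbreviation "Single t \<equiv> Pair t tm.Nil"
abbreviation "One \<equiv> FldC (IntC 1)"
abbreviation "Zero \<equiv> FldC (IntC 0)"
abbreviation "Basis a b c d v w \<equiv> Pair a (Pair b (Pair c (Pair d (Pair v w))))"

text \<open>
  Arguments are passed as nested pairs. Function \<open>i\<close> is entry \<open>i\<close> of \<open>rfr_code\<close>, and function
  \<open>15\<close> is the entry point of the given multiplication program, whose calls are relabelled
  accordingly.

  \<^item> 0: \<open>(p, l, m, S)\<close> to the solution
  \<^item> 1: \<open>(xs, acc)\<close> to \<open>rev xs @ acc\<close>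
  \<^item> 2: \<open>xs\<close> without its leading zeros
  \<^item> 3: \<open>(n, xs)\<close> to \<open>drop n xs\<close>
  \<^item> 4: \<open>(n, xs, acc)\<close> to \<open>rev (take n xs) @ acc\<close>
  \<^item> 5: \<open>(xs, ys, acc)\<close>, coefficients with the constant one first, to their reversed sum before \<open>acc\<close>
  \<^item> 6: sum of polynomials
  \<^item> 7: \<open>(p, A, B, C, D)\<close> to \<open>A B + C D\<close>
  \<^item> 8, 9: \<open>(n, A)\<close> to the remainder and to the quotient of \<open>A\<close> by \<open>X ^ n\<close>
  \<^item> 10: constant coefficient
  \<^item> 11: \<open>(w1, w2, a, b)\<close> to an order basis for \<open>n = 1\<close>, where \<open>a\<close>, \<open>b\<close> are the constant coefficients
  \<^item> 12: \<open>(p, n, w1, w2, f, g)\<close> to an order basis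
  \<^item> 13: \<open>(p, m, Q)\<close> to the minimal row of the order basis \<open>Q\<close>
  \<^item> 14: \<open>(p, Y)\<close> to the monic multiple of \<open>Y\<close>
\<close>

definition revapp_code :: tm where
  "revapp_code = CaseList (Fst (Var 0)) (Snd (Var 0))
     (Call 1 (Pair (Var 1) (Pair (Var 0) (Snd (Var 2)))))"

abbreviation "Rev t \<equiv> Call 1 (Pair t tm.Nil)"

definition strip_code :: tm where
  "strip_code = CaseList (Var 0) tm.Nil (IfZero (Var 0) (Call 2 (Var 1)) (Var 2))"

definition drop_code :: tm where
  "drop_code = IfPos (Fst (Var 0))
     (CaseList (Snd (Var 0)) tm.Nil (Call 3 (Pair (IntOp ISub (Fst (Var 2)) (IntC 1)) (Var 1))))
     (Snd (Var 0))"

definition takerev_code :: tm where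
  "takerev_code = IfPos (Fst (Var 0))
     (CaseList (Fst (Snd (Var 0))) (Snd2 (Var 0))
        (Call 4 (Pair (IntOp ISub (Fst (Var 2)) (IntC 1)) (Pair (Var 1) (Pair (Var 0) (Snd2 (Var
            2)))))))
     (Snd2 (Var 0))"

definition addrev_code :: tm where
  "addrev_code = CaseList (Fst (Var 0)) (Call 1 (Pair (Fst (Snd (Var 0))) (Snd2 (Var 0))))
     (CaseList (Fst (Snd (Var 2))) (Call 1 (Pair (Fst (Var 2)) (Snd2 (Var 2))))
        (Call 5 (Pair (Var 3) (Pair (Var 1) (Pair (FldOp FAdd (Var 2) (Var 0)) (Snd2 (Var 4)))))))"

definition add_code :: tm where
  "add_code = Call 2 (Call 5 (Pair (Rev (Fst (Var 0))) (Pair (Rev (Snd (Var 0))) tm.Nil)))"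

abbreviation "PMul p s t \<equiv> Call 15 (Pair p (Pair s t))"

definition dot_code :: tm where
  "dot_code = Call 6 (Pair (PMul (Fst (Var 0)) (Fst (Snd (Var 0))) (Fst (Snd2 (Var 0))))
     (PMul (Fst (Var 0)) (Fst (Snd3 (Var 0))) (Snd4 (Var 0))))"

abbreviation "Dot p a b c d \<equiv> Call 7 (Pair p (Pair a (Pair b (Pair c d))))"

definition trunc_code :: tm where
  "trunc_code = Call 2 (Call 4 (Pair (Fst (Var 0)) (Pair (Rev (Snd (Var 0))) tm.Nil)))"

abbreviation "Trunc n t \<equiv> Call 8 (Pair n t)"

definition shift_code :: tm where
  "shift_code = Rev (Call 3 (Pair (Fst (Var 0)) (Rev (Snd (Var 0)))))"

abbreviation "Shift n t \<equiv> Call 9 (Pair n t)"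

definition coeff0_code :: tm where
  "coeff0_code = CaseList (Rev (Var 0)) Zero (Var 0)"

abbreviation "Coeff0 t \<equiv> Call 10 t"

abbreviation "NegQuot s t \<equiv> FldOp FSub Zero (FldOp FDiv s t)"

definition step_code :: tm where
  "step_code = (let w1 = Fst (Var 0); w2 = Fst (Snd (Var 0)); a = Fst (Snd2 (Var 0)); b = Snd3
      (Var 0);
       x = Pair One (Single Zero)
     in IfZero a (Basis (Single One) tm.Nil tm.Nil x w1 (IntOp IAdd w2 (IntC 1)))
       (IfZero b (Basis x tm.Nil tm.Nil (Single One) (IntOp IAdd w1 (IntC 1)) w2)
         (IfPos (IntOp ISub w1 w2)
           (Basis (Single One) (Single (NegQuot a b)) tm.Nil x w1 (IntOp IAdd w2 (IntC 1)))
           (Basis x tm.Nil (Single (NegQuot b a)) (Single One) (IntOp IAdd w1 (IntC 1)) w2))))"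

definition basis_code :: tm where
  "basis_code = LetIn (Trunc (Fst (Snd (Var 0))) (Fst (Snd4 (Var 0))))
     (LetIn (Trunc (Fst (Snd (Var 1))) (Snd (Snd4 (Var 1))))
       (IfPos (IntOp ISub (Fst (Snd (Var 2))) (IntC 1))
         (LetIn (IntOp IDiv (Fst (Snd (Var 2))) (IntC 2))
           (LetIn (Call 12 (Pair (Fst (Var 3)) (Pair (Var 0) (Pair (Fst (Snd2 (Var 3)))
                     (Pair (Fst (Snd3 (Var 3))) (Pair (Var 2) (Var 1)))))))
             (LetIn (Call 12 (Pair (Fst (Var 4)) (Pair (IntOp ISub (Fst (Snd (Var 4))) (Var 1))
                       (Pair (Fst (Snd4 (Var 0))) (Pair (Snd (Snd4 (Var 0)))
                         (Pair (Shift (Var 1) (Dot (Fst (Var 4)) (Fst (Var 0)) (Var 3) (Fst (Snd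
                             (Var 0))) (Var 2)))
                               (Shift (Var 1) (Dot (Fst (Var 4)) (Fst (Snd2 (Var 0))) (Var 3) (Fst
                                   (Snd3 (Var 0))) (Var 2)))))))))
               (Pair (Dot (Fst (Var 5)) (Fst (Var 0)) (Fst (Var 1)) (Fst (Snd (Var 0))) (Fst (Snd2
                   (Var 1))))
               (Pair (Dot (Fst (Var 5)) (Fst (Var 0)) (Fst (Snd (Var 1))) (Fst (Snd (Var 0))) (Fst
                   (Snd3 (Var 1))))
               (Pair (Dot (Fst (Var 5)) (Fst (Snd2 (Var 0))) (Fst (Var 1)) (Fst (Snd3 (Var 0)))
                   (Fst (Snd2 (Var 1))))
               (Pair (Dot (Fst (Var 5)) (Fst (Snd2 (Var 0))) (Fst (Snd (Var 1))) (Fst (Snd3 (Var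
                   0))) (Fst (Snd3 (Var 1))))
                 (Snd4 (Var 0)))))))))
         (Call 11 (Pair (Fst (Snd2 (Var 2))) (Pair (Fst (Snd3 (Var 2))) (Pair (Coeff0 (Var 1))
             (Coeff0 (Var 0))))))))"

definition row_code :: tm where
  "row_code = (let a1 = (\<lambda>t. Fst (Snd2 t)); b1 = (\<lambda>t. Fst (Snd3 t)); a2 = (\<lambda>t. Fst (Snd4 t));
       b2 = (\<lambda>t. Fst (Snd (Snd4 t))); d1 = (\<lambda>t. Fst (Snd2 (Snd4 t))); d2 = (\<lambda>t. Snd3 (Snd4 t));
       top = (\<lambda>s t u. FldOp FSub (Coeff0 (Shift (d1 u) s)) (Coeff0 (Shift (IntOp ISub (d1 u) (Fst
           (Snd u))) t)))
     in IfPos (IntOp ISub (d2 (Var 0)) (d1 (Var 0))) (Pair (a1 (Var 0)) (b1 (Var 0)))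
       (IfPos (IntOp ISub (d1 (Var 0)) (d2 (Var 0))) (Pair (a2 (Var 0)) (b2 (Var 0)))
         (LetIn (top (a1 (Var 0)) (b1 (Var 0)) (Var 0))
           (LetIn (top (a2 (Var 1)) (b2 (Var 1)) (Var 1))
             (IfZero (Var 1) (Pair (a1 (Var 2)) (b1 (Var 2)))
               (IfZero (Var 0) (Pair (a2 (Var 2)) (b2 (Var 2)))
                 (LetIn (Single (NegQuot (Var 0) (Var 1)))
                   (Pair (Dot (Fst (Var 3)) (Var 0) (a1 (Var 3)) (Single One) (a2 (Var 3)))
                     (Dot (Fst (Var 3)) (Var 0) (b1 (Var 3)) (Single One) (b2 (Var 3)))))))))))"

definition monic_code :: tm where
  "monic_code = CaseList (Snd (Var 0)) tm.Nil
     (PMul (Fst (Var 2)) (Single (FldOp FDiv One (Var 0))) (Snd (Var 2)))"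

definition main_code :: tm where
  "main_code = LetIn
     (Call 13 (Pair (Fst (Var 0)) (Pair (Fst (Snd2 (Var 0)))
       (Call 12 (Pair (Fst (Var 0)) (Pair (Fst (Snd (Var 0))) (Pair (IntC 0) (Pair (Fst (Snd2 (Var
           0)))
         (Pair (Single (FldC (IntC (-1)))) (Snd3 (Var 0)))))))))))
     (Pair (Call 14 (Pair (Fst (Var 1)) (Fst (Var 0)))) (Call 14 (Pair (Fst (Var 1)) (Snd (Var
         0)))))"

definition rfr_code :: prog where
  "rfr_code = [main_code, revapp_code, strip_code, drop_code, takerev_code, addrev_code, add_code,
      dot_code,
     trunc_code, shift_code, coeff0_code, step_code, basis_code, row_code, monic_code]"

lemma length_rfr_code: "length rfr_code = 15"
  by (simp add: rfr_code_def)

definition rfr_prog :: "prog \<Rightarrow> prog" where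
  "rfr_prog M = rfr_code @ map (relabel 15) M"

lemma app_rfr_prog:
  "app K (rfr_prog M) 0 u = ev K (rfr_prog M) [u] main_code"
  "app K (rfr_prog M) 1 u = ev K (rfr_prog M) [u] revapp_code"
  "app K (rfr_prog M) 2 u = ev K (rfr_prog M) [u] strip_code"
  "app K (rfr_prog M) 3 u = ev K (rfr_prog M) [u] drop_code"
  "app K (rfr_prog M) 4 u = ev K (rfr_prog M) [u] takerev_code"
  "app K (rfr_prog M) 5 u = ev K (rfr_prog M) [u] addrev_code"
  "app K (rfr_prog M) 6 u = ev K (rfr_prog M) [u] add_code"
  "app K (rfr_prog M) 7 u = ev K (rfr_prog M) [u] dot_code"
  "app K (rfr_prog M) 8 u = ev K (rfr_prog M) [u] trunc_code"
  "app K (rfr_prog M) 9 u = ev K (rfr_prog M) [u] shift_code"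
  "app K (rfr_prog M) 10 u = ev K (rfr_prog M) [u] coeff0_code"
  "app K (rfr_prog M) 11 u = ev K (rfr_prog M) [u] step_code"
  "app K (rfr_prog M) 12 u = ev K (rfr_prog M) [u] basis_code"
  "app K (rfr_prog M) 13 u = ev K (rfr_prog M) [u] row_code"
  "app K (rfr_prog M) 14 u = ev K (rfr_prog M) [u] monic_code"
  by (simp_all add: app_def rfr_prog_def rfr_code_def)

lemma app_multiplier:
  assumes "run K M u v c"
  shows "app K (rfr_prog M) 15 u = Some (v, c)"
proof -
  have "exec K M [u] (Call 0 (Var 0)) v c" using assms by (simp add: run_def)
  then have "M \<noteq> []" "exec K M [u] (M ! 0) v c"
    by (auto elim!: exec_elims)
  then show ?thesis
    using exec_relabel[of K M "[u]" "M ! 0" v c rfr_code]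
    by (simp add: app_def rfr_prog_def length_rfr_code ev_eq_Some_iff nth_append)
qed

section \<open>Correctness and cost of the program\<close>

locale rfr_machine = field_polynomials R P for R (structure) and P +
  fixes M :: prog and TM :: "nat \<Rightarrow> nat" and p :: int
  assumes mult: "A \<in> carrier P \<Longrightarrow> B \<in> carrier P \<Longrightarrow> degree A \<le> n \<Longrightarrow> degree B \<le> n \<Longrightarrow>
    \<exists>c \<le> TM n. run R M (VPair (VInt p) (VPair (poly_val A) (poly_val B))) (poly_val (A \<boxtimes> B)) c"
begin

abbreviation "code \<equiv> rfr_prog M"
abbreviation "call f u \<equiv> app R code f u"

lemma int_consts: "[(1::int)] \<cdot> \<one> = \<one>" "[(0::int)] \<cdot> \<one> = \<zero>" "[(- 1::int)] \<cdot> \<one> = \<ominus> \<one>"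
  using add.int_pow_1[of \<one>] add.int_pow_neg[of \<one> 1] int_pow_0[of "add_monoid R" \<one>]
  by (simp_all add: add_pow_def)

section \<open>List routines and polynomial arithmetic of the program\<close>

lemma call_revapp: "call (Suc 0) (VPair (poly_val xs) (poly_val acc)) = Some (poly_val (rev xs @
    acc), 0)"
proof (induction xs arbitrary: acc)
  case Nil
  show ?case by (subst app_rfr_prog(2)[unfolded One_nat_def]) (simp add: revapp_code_def ev_simps)
next
  case (Cons x xs)
  show ?case using Cons[of "x # acc"]
    by (subst app_rfr_prog(2)[unfolded One_nat_def]) (simp add: revapp_code_def ev_simps)
qed

lemma call_rev: "call (Suc 0) (VPair (poly_val xs) VNil) = Some (poly_val (rev xs), 0)"
  using call_revapp[of xs "[]"] by simp

lemma call_strip: "\<exists>c \<le> length xs. call 2 (poly_val xs) = Some (poly_val (normalize xs), c)"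
proof (induction xs)
  case Nil
  show ?case by (subst app_rfr_prog) (simp add: strip_code_def ev_simps)
next
  case (Cons x xs)
  then show ?case
    by (subst app_rfr_prog) (auto simp: strip_code_def ev_simps)
qed

lemma call_drop: "call 3 (VPair (VInt n) (poly_val xs)) = Some (poly_val (drop (nat n) xs), 0)"
proof (induction xs arbitrary: n)
  case Nil
  show ?case by (subst app_rfr_prog) (simp add: drop_code_def ev_simps)
next
  case (Cons x xs)
  show ?case using Cons[of "n - 1"]
    by (subst app_rfr_prog) (simp add: drop_code_def ev_simps drop_Cons' nat_diff_distrib)
qed

lemma call_takerev: "call 4 (VPair (VInt n) (VPair (poly_val xs) (poly_val acc))) =
  Some (poly_val (rev (take (nat n) xs) @ acc), 0)"
proof (induction xs arbitrary: n acc)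
  case Nil
  show ?case by (subst app_rfr_prog) (simp add: takerev_code_def ev_simps)
next
  case (Cons x xs)
  show ?case using Cons[of "n - 1" "x # acc"]
    by (subst app_rfr_prog) (simp add: takerev_code_def ev_simps take_Cons' nat_diff_distrib)
qed

text \<open>Models function 5 without its accumulator. With constant coefficients first, summands of
  different length align at their low ends.\<close>

fun addrev :: "'a list \<Rightarrow> 'a list \<Rightarrow> 'a list" where
  "addrev [] ys = rev ys"
| "addrev xs [] = rev xs"
| "addrev (x # xs) (y # ys) = addrev xs ys @ [x \<oplus> y]"

lemma call_addrev: "call 5 (VPair (poly_val xs) (VPair (poly_val ys) (poly_val acc))) =
  Some (poly_val (addrev xs ys @ acc), min (length xs) (length ys))"
proof (induction xs ys arbitrary: acc rule: addrev.induct)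
  case (1 ys)
  show ?case by (subst app_rfr_prog) (simp add: addrev_code_def ev_simps call_revapp)
next
  case (2 x xs)
  show ?case using call_revapp[of "x # xs" acc]
    by (subst app_rfr_prog) (simp add: addrev_code_def ev_simps)
next
  case (3 x xs y ys)
  show ?case using 3[of "(x \<oplus> y) # acc"]
    by (subst app_rfr_prog) (simp add: addrev_code_def ev_simps)
qed

lemma length_addrev: "length (addrev xs ys) = max (length xs) (length ys)"
  by (induction xs ys rule: addrev.induct) auto

lemma addrev_closed: "set xs \<subseteq> carrier R \<Longrightarrow> set ys \<subseteq> carrier R \<Longrightarrow> set (addrev xs ys) \<subseteq> carrier R"
  by (induction xs ys rule: addrev.induct) auto

lemma coeff_addrev:
  "set xs \<subseteq> carrier R \<Longrightarrow> set ys \<subseteq> carrier R \<Longrightarrow>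
    coeff (addrev xs ys) i = coeff (rev xs) i \<oplus> coeff (rev ys) i"
proof (induction xs ys arbitrary: i rule: addrev.induct)
  case (3 x xs y ys)
  then show ?case by (auto simp: append_coeff)
qed (auto simp: set_rev)

lemma normalize_addrev:
  assumes "A \<in> carrier P" "B \<in> carrier P"
  shows "normalize (addrev (rev A) (rev B)) = A \<boxplus> B"
proof (rule poly_eqI)
  show "normalize (addrev (rev A) (rev B)) \<in> carrier P"
    unfolding carrierP_iff
    by (intro normalize_gives_polynomial addrev_closed) (use assms set_carrierP in auto)
  show "coeff (normalize (addrev (rev A) (rev B))) i = coeff (A \<boxplus> B) i" for i
    using assms by (simp add: normalize_coeff[symmetric] coeff_addrev set_carrierP coeff_add)
qed (use assms in auto)

text \<open>At most \<open>n\<close> additions and, since leading terms may cancel, at most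
  \<open>n\<close> zero tests for stripping.\<close>

lemma call_add:
  assumes "A \<in> carrier P" "B \<in> carrier P" "length A \<le> n" "length B \<le> n"
  shows "\<exists>c \<le> 2 * n. call 6 (VPair (poly_val A) (poly_val B)) = Some (poly_val (A \<boxplus> B), c)"
proof -
  obtain c where "c \<le> max (length A) (length B)"
    "call 2 (poly_val (addrev (rev A) (rev B))) = Some (poly_val (A \<boxplus> B), c)"
    using call_strip[of "addrev (rev A) (rev B)"] normalize_addrev[OF assms(1,2)]
    by (auto simp: length_addrev)
  then show ?thesis using call_addrev[of "rev A" "rev B" "[]"] assms
    by (subst app_rfr_prog) (auto simp: add_code_def ev_simps call_rev)
qed

text \<open>The multiplication hypothesis accepts any common degree bound, so small operands may be
  charged at a larger \<open>n\<close> without \<open>TM\<close> being monotone.\<close>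

lemma call_mult:
  assumes "A \<in> carrier P" "B \<in> carrier P" "deg_le A (int n)" "deg_le B (int n)"
  shows "\<exists>c \<le> TM n. call 15 (VPair (VInt p) (VPair (poly_val A) (poly_val B))) = Some (poly_val (A
      \<boxtimes> B), c)"
  using mult[of A B n] app_multiplier assms deg_le_length[of A n] deg_le_length[of B n] by fastforce

text \<open>The products have at most \<open>2 * n + 1\<close> coefficients each, and
  \<open>call_add\<close> charges two operations per coefficient.\<close>

lemma call_dot:
  assumes c: "A \<in> carrier P" "B \<in> carrier P" "C \<in> carrier P" "D \<in> carrier P"
    and d: "deg_le A (int n)" "deg_le B (int n)" "deg_le C (int n)" "deg_le D (int n)"
  shows "\<exists>c \<le> 2 * TM n + 4 * n + 2. call 7 (VPair (VInt p) (VPair (poly_val A) (VPair (poly_val B)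
    (VPair (poly_val C) (poly_val D))))) = Some (poly_val (A \<boxtimes> B \<boxplus> C \<boxtimes> D), c)"
proof -
  obtain c1 where 1: "c1 \<le> TM n" "call 15 (VPair (VInt p) (VPair (poly_val A) (poly_val B))) =
      Some (poly_val (A \<boxtimes> B), c1)"
    using call_mult c d by blast
  obtain c2 where 2: "c2 \<le> TM n" "call 15 (VPair (VInt p) (VPair (poly_val C) (poly_val D))) =
      Some (poly_val (C \<boxtimes> D), c2)"
    using call_mult c d by blast
  have "deg_le (A \<boxtimes> B) (int (2 * n))" "deg_le (C \<boxtimes> D) (int (2 * n))"
    using c d by (auto intro: deg_le_mult)
  then have "length (A \<boxtimes> B) \<le> 2 * n + 1" "length (C \<boxtimes> D) \<le> 2 * n + 1"
    using c by (simp_all only: deg_le_length P.m_closed Suc_eq_plus1)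
  then obtain c3 where 3: "c3 \<le> 4 * n + 2"
    "call 6 (VPair (poly_val (A \<boxtimes> B)) (poly_val (C \<boxtimes> D))) = Some (poly_val (A \<boxtimes> B \<boxplus> C \<boxtimes> D), c3)"
    using call_add[of "A \<boxtimes> B" "C \<boxtimes> D" "2 * n + 1"] c by auto
  show ?thesis using 1 2 3 by (subst app_rfr_prog) (auto simp: dot_code_def ev_simps)
qed

lemma call_trunc:
  "\<exists>c \<le> n. call 8 (VPair (VInt (int n)) (poly_val A)) = Some (poly_val (trunc n A), c)"
proof -
  have "rev (take n (rev A)) = drop (length A - n) A" by (simp add: take_rev)
  moreover obtain c where "c \<le> length (drop (length A - n) A)"
    "call 2 (poly_val (drop (length A - n) A)) = Some (poly_val (trunc n A), c)"
    using call_strip[of "drop (length A - n) A"] unfolding trunc_def by blast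
  ultimately show ?thesis using call_takerev[of "int n" "rev A" "[]"]
    by (subst app_rfr_prog) (auto simp: trunc_code_def ev_simps call_rev)
qed

lemma call_shift:
  "call 9 (VPair (VInt n) (poly_val A)) = Some (poly_val (shift (nat n) A), 0)"
proof -
  have "rev (drop (nat n) (rev A)) = shift (nat n) A" by (simp add: drop_rev shift_def)
  then show ?thesis
    by (subst app_rfr_prog) (simp add: shift_code_def ev_simps call_rev call_drop)
qed

lemma call_coeff0: "call 10 (poly_val A) = Some (VFld (coeff A 0), 0)"
proof (cases A rule: rev_cases)
  case Nil
  then show ?thesis using call_rev[of "[]"]
    by (subst app_rfr_prog) (simp add: coeff0_code_def ev_simps int_consts)
next
  case (snoc A' a)
  then show ?thesis using call_rev[of A]
    by (subst app_rfr_prog) (simp add: coeff0_code_def ev_simps append_coeff)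
qed

definition basis_val where
  "basis_val A1 B1 A2 B2 v1 v2 = VPair (poly_val A1) (VPair (poly_val B1) (VPair (poly_val A2)
     (VPair (poly_val B2) (VPair (VInt v1) (VInt v2)))))"

text \<open>The worst case is two zero tests, a division, and a subtraction from zero that negates
  the quotient.\<close>

lemma call_step:
  assumes f: "f \<in> carrier P" and g: "g \<in> carrier P"
  shows "\<exists>A1 B1 A2 B2 v1 v2. \<exists>c \<le> 4. order_basis 1 w1 w2 f g A1 B1 A2 B2 v1 v2 \<and>
    call 11 (VPair (VInt w1) (VPair (VInt w2) (VPair (VFld (coeff f 0)) (VFld (coeff g 0))))) =
      Some (basis_val A1 B1 A2 B2 v1 v2, c)"
proof -
  let ?a = "coeff f 0" and ?b = "coeff g 0"
  have ab: "?a \<in> carrier R" "?b \<in> carrier R" using f g by simp_all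
  have q: "\<zero> \<ominus> x = \<ominus> x" if "x \<in> carrier R" for x using that by (simp add: minus_eq)
  have i: "inv x \<in> carrier R" if "x \<in> carrier R" "x \<noteq> \<zero>" for x using that by (simp add: field_Units)
  note ob = order_basis_step[OF f g refl refl, where ?w1.0 = w1 and ?w2.0 = w2]
  note [simp] = ab q i step_code_def Let_def ev_simps int_consts basis_val_def var_def
  consider "?a = \<zero>" | "?a \<noteq> \<zero>" "?b = \<zero>" | "?a \<noteq> \<zero>" "?b \<noteq> \<zero>" "w2 < w1"
    | "?a \<noteq> \<zero>" "?b \<noteq> \<zero>" "w1 \<le> w2" by linarith
  then show ?thesis
  proof cases
    case 1
    show ?thesis
      by (rule exI, rule exI, rule exI, rule exI, rule exI, rule exI, rule exI[of _ 1], rule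
          conjI[OF _ conjI[OF ob(1)]])
        (use 1 in \<open>simp_all add: app_rfr_prog\<close>)
  next
    case 2
    show ?thesis
      by (rule exI, rule exI, rule exI, rule exI, rule exI, rule exI, rule exI[of _ 2], rule
          conjI[OF _ conjI[OF ob(2)]])
        (use 2 in \<open>simp_all add: app_rfr_prog\<close>)
  next
    case 3
    show ?thesis
      by (rule exI, rule exI, rule exI, rule exI, rule exI, rule exI, rule exI[of _ 4], rule
          conjI[OF _ conjI[OF ob(4)]])
        (use 3 in \<open>simp_all add: app_rfr_prog\<close>)
  next
    case 4
    show ?thesis
      by (rule exI, rule exI, rule exI, rule exI, rule exI, rule exI, rule exI[of _ 4], rule
          conjI[OF _ conjI[OF ob(3)]])
        (use 4 in \<open>simp_all add: app_rfr_prog\<close>)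
  qed
qed

end

fun depth :: "nat \<Rightarrow> nat" where
  "depth n = (if n \<le> 1 then 0 else Suc (depth (n - n div 2)))"

declare depth.simps [simp del]

lemma depth_mono: "m \<le> n \<Longrightarrow> depth m \<le> depth n"
proof (induction n arbitrary: m rule: less_induct)
  case (less n)
  show ?case
  proof (cases "m \<le> 1")
    case True
    then show ?thesis by (simp add: depth.simps[of m])
  next
    case False
    then have "depth (m - m div 2) \<le> depth (n - n div 2)"
      using less.prems by (intro less.IH) linarith+
    then show ?thesis using False less.prems by (simp add: depth.simps[of m] depth.simps[of n])
  qed
qed

text \<open>The \<open>n - 1\<close> makes the induction close: for the larger half k of n, 2 (k -
  1) <= n - 1, whereas 2 k may exceed n.\<close>

lemma two_power_depth: "2 \<le> n \<Longrightarrow> 2 ^ depth n \<le> 2 * (n - 1)"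
proof (induction n rule: less_induct)
  case (less n)
  show ?case
  proof (cases "n = 2")
    case True
    then show ?thesis by (simp add: depth.simps)
  next
    case False
    then have "2 ^ depth (n - n div 2) \<le> 2 * (n - n div 2 - 1)"
      using less.prems by (intro less.IH) linarith+
    then have "2 ^ depth n \<le> 2 * (2 * (n - n div 2 - 1))" using less.prems by (simp add:
        depth.simps[of n])
    also have "\<dots> \<le> 2 * (n - 1)" using less.prems by linarith
    finally show ?thesis .
  qed
qed

text \<open>Both halves are charged at the depth of the larger one, which is one less than
  \<open>depth n\<close>; the summand \<open>n\<close> pays for the current level.\<close>

lemma depth_recurrence:
  assumes n: "2 \<le> n" and h: "h = n div 2"
  shows "h * (depth h + 1) + (n - h) * (depth (n - h) + 1) + n \<le> n * (depth n + 1)"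
proof -
  have "h * (depth h + 1) \<le> h * (depth (n - h) + 1)"
    using n h depth_mono[of h "n - h"] by (intro mult_left_mono) auto
  then have "h * (depth h + 1) + (n - h) * (depth (n - h) + 1) \<le> (h + (n - h)) * (depth (n - h) +
      1)"
    by (simp only: add_mult_distrib)
  also have "\<dots> = n * (depth (n - h) + 1)" using h by simp
  finally have "h * (depth h + 1) + (n - h) * (depth (n - h) + 1) + n \<le> n * (depth (n - h) + 1) + n"
    by (rule add_right_mono)
  also have "\<dots> = n * (depth n + 1)" using n h by (simp add: depth.simps[of n])
  finally show ?thesis .
qed

section \<open>The recursive basis computation and the complete program\<close>

context rfr_machine
begin

lemma deg_le_trunc: "deg_le (trunc n A) (int n)"
  by (simp add: deg_le_def coeff_trunc)

text \<open>As \<open>\<mu>\<close> is a common linear rate for all sizes up to \<open>n\<close>,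
  the costs of the two halves add up in the same unit. The weights are generalised because the
  second recursive call starts from the row degrees of the first basis.\<close>

lemma call_basis:
  assumes "0 < n" "f \<in> carrier P" "g \<in> carrier P" "\<And>k. 0 < k \<Longrightarrow> k \<le> n \<Longrightarrow> TM k \<le> k * \<mu>"
  shows "\<exists>A1 B1 A2 B2 v1 v2. \<exists>c \<le> 38 * (n * (depth n + 1)) * (\<mu> + 1).
    order_basis n w1 w2 f g A1 B1 A2 B2 v1 v2 \<and>
    call 12 (VPair (VInt p) (VPair (VInt (int n)) (VPair (VInt w1) (VPair (VInt w2)
      (VPair (poly_val f) (poly_val g)))))) = Some (basis_val A1 B1 A2 B2 v1 v2, c)"
  using assms
proof (induction n arbitrary: w1 w2 f g rule: less_induct)
  case (less n)
  define f' g' where "f' = trunc n f" and "g' = trunc n g"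
  have fg: "f' \<in> carrier P" "g' \<in> carrier P" using less.prems by (simp_all add: f'_def g'_def)
  obtain cf where cf: "cf \<le> n" "call 8 (VPair (VInt (int n)) (poly_val f)) = Some (poly_val f', cf)"
    using call_trunc[of n f] by (auto simp: f'_def)
  obtain cg where cg: "cg \<le> n" "call 8 (VPair (VInt (int n)) (poly_val g)) = Some (poly_val g', cg)"
    using call_trunc[of n g] by (auto simp: g'_def)
  show ?case
  proof (cases "n = 1")
    case True
    obtain A1 B1 A2 B2 v1 v2 c where step: "c \<le> 4" "order_basis 1 w1 w2 f' g' A1 B1 A2 B2 v1 v2"
      "call 11 (VPair (VInt w1) (VPair (VInt w2) (VPair (VFld (coeff f' 0)) (VFld (coeff g' 0))))) =
        Some (basis_val A1 B1 A2 B2 v1 v2, c)"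
      using call_step[OF fg, of w1 w2] by blast
    have ob: "order_basis n w1 w2 f g A1 B1 A2 B2 v1 v2"
      using order_basis_trunc[of n w1 w2 f g A1 B1 A2 B2 v1 v2] step(2) less.prems True
      by (simp add: f'_def g'_def)
    have "call 12 (VPair (VInt p) (VPair (VInt (int n)) (VPair (VInt w1) (VPair (VInt w2)
      (VPair (poly_val f) (poly_val g)))))) = Some (basis_val A1 B1 A2 B2 v1 v2, cf + (cg + c))"
      using cf(2) cg(2) step(3) True
      by (subst app_rfr_prog) (simp add: basis_code_def ev_simps call_coeff0)
    moreover have "cf + (cg + c) \<le> 38 * (n * (depth n + 1)) * (\<mu> + 1)"
      using cf(1) cg(1) step(1) True by simp
    ultimately show ?thesis using ob by blast
  next
    case False
    define h where "h = n div 2"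
    have h: "0 < h" "h < n" "0 < n - h" "n - h < n" "h \<le> n" using less.prems(1) False by (auto
        simp: h_def)
    have pos: "Suc 0 < n" using less.prems(1) False by linarith
    have hn: "int n div 2 = int h" "int n - int h = int (n - h)" "h + (n - h) = n"
      using h by (auto simp: h_def zdiv_int)
    obtain A1 B1 A2 B2 v1 v2 c1 where c1: "c1 \<le> 38 * (h * (depth h + 1)) * (\<mu> + 1)"
      and Q: "order_basis h w1 w2 f' g' A1 B1 A2 B2 v1 v2"
      and e1: "call 12 (VPair (VInt p) (VPair (VInt (int h)) (VPair (VInt w1) (VPair (VInt w2)
        (VPair (poly_val f') (poly_val g')))))) = Some (basis_val A1 B1 A2 B2 v1 v2, c1)"
      using less.IH[OF h(2,1) fg, of w1 w2] less.prems(4) h by fastforce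
    have cl1: "A1 \<in> carrier P" "B1 \<in> carrier P" "A2 \<in> carrier P" "B2 \<in> carrier P"
      using Q by (simp_all add: order_basis_def)
    define r s where "r = A1 \<boxtimes> f' \<boxplus> B1 \<boxtimes> g'" and "s = A2 \<boxtimes> f' \<boxplus> B2 \<boxtimes> g'"
    have rs: "shift h r \<in> carrier P" "shift h s \<in> carrier P"
      using cl1 fg by (simp_all add: r_def s_def)
    obtain C1 D1 C2 D2 u1 u2 c2 where c2: "c2 \<le> 38 * ((n - h) * (depth (n - h) + 1)) * (\<mu> + 1)"
      and C: "order_basis (n - h) v1 v2 (shift h r) (shift h s) C1 D1 C2 D2 u1 u2"
      and e2: "call 12 (VPair (VInt p) (VPair (VInt (int (n - h))) (VPair (VInt v1) (VPair (VInt v2)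
        (VPair (poly_val (shift h r)) (poly_val (shift h s))))))) = Some (basis_val C1 D1 C2 D2 u1
            u2, c2)"
      using less.IH[OF h(4,3) rs, of v1 v2] less.prems(4) h by fastforce
    have cl2: "C1 \<in> carrier P" "D1 \<in> carrier P" "C2 \<in> carrier P" "D2 \<in> carrier P"
      using C by (simp_all add: order_basis_def)
    have "deg_le A1 (int h)" "deg_le B1 (int h)" "deg_le A2 (int h)" "deg_le B2 (int h)"
      "deg_le C1 (int (n - h))" "deg_le D1 (int (n - h))" "deg_le C2 (int (n - h))" "deg_le D2
          (int (n - h))"
      using Q C by (simp_all only: order_basis_def)
    then have d: "deg_le A1 (int n)" "deg_le B1 (int n)" "deg_le A2 (int n)" "deg_le B2 (int n)"
      "deg_le C1 (int n)" "deg_le D1 (int n)" "deg_le C2 (int n)" "deg_le D2 (int n)"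
      "deg_le f' (int n)" "deg_le g' (int n)"
      using deg_le_mono[of _ "int h" "int n"] deg_le_mono[of _ "int (n - h)" "int n"] h(5)
      by (simp_all add: f'_def g'_def deg_le_trunc)
    let ?dot = "\<lambda>A B C D. call 7 (VPair (VInt p) (VPair (poly_val A) (VPair (poly_val B)
      (VPair (poly_val C) (poly_val D)))))"
    define b where "b = 2 * TM n + 4 * n + 2"
    obtain x1 where x1: "x1 \<le> b" "?dot A1 f' B1 g' = Some (poly_val r, x1)"
      using call_dot[of A1 f' B1 g' n] cl1 fg d by (auto simp: b_def r_def)
    obtain x2 where x2: "x2 \<le> b" "?dot A2 f' B2 g' = Some (poly_val s, x2)"
      using call_dot[of A2 f' B2 g' n] cl1 fg d by (auto simp: b_def s_def)
    obtain x3 where x3: "x3 \<le> b" "?dot C1 A1 D1 A2 = Some (poly_val (C1 \<boxtimes> A1 \<boxplus> D1 \<boxtimes> A2), x3)"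
      using call_dot[of C1 A1 D1 A2 n] cl1 cl2 d by (auto simp: b_def)
    obtain x4 where x4: "x4 \<le> b" "?dot C1 B1 D1 B2 = Some (poly_val (C1 \<boxtimes> B1 \<boxplus> D1 \<boxtimes> B2), x4)"
      using call_dot[of C1 B1 D1 B2 n] cl1 cl2 d by (auto simp: b_def)
    obtain x5 where x5: "x5 \<le> b" "?dot C2 A1 D2 A2 = Some (poly_val (C2 \<boxtimes> A1 \<boxplus> D2 \<boxtimes> A2), x5)"
      using call_dot[of C2 A1 D2 A2 n] cl1 cl2 d by (auto simp: b_def)
    obtain x6 where x6: "x6 \<le> b" "?dot C2 B1 D2 B2 = Some (poly_val (C2 \<boxtimes> B1 \<boxplus> D2 \<boxtimes> B2), x6)"
      using call_dot[of C2 B1 D2 B2 n] cl1 cl2 d by (auto simp: b_def)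
    have ob: "order_basis n w1 w2 f g (C1 \<boxtimes> A1 \<boxplus> D1 \<boxtimes> A2) (C1 \<boxtimes> B1 \<boxplus> D1 \<boxtimes> B2)
        (C2 \<boxtimes> A1 \<boxplus> D2 \<boxtimes> A2) (C2 \<boxtimes> B1 \<boxplus> D2 \<boxtimes> B2) u1 u2"
      using order_basis_compose[OF Q fg C[unfolded r_def s_def]]
      unfolding hn(3) f'_def g'_def by (rule order_basis_trunc[OF _ less.prems(2,3)])
    have code: "call 12 (VPair (VInt p) (VPair (VInt (int n)) (VPair (VInt w1) (VPair (VInt w2)
        (VPair (poly_val f) (poly_val g)))))) =
      Some (basis_val (C1 \<boxtimes> A1 \<boxplus> D1 \<boxtimes> A2) (C1 \<boxtimes> B1 \<boxplus> D1 \<boxtimes> B2)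
        (C2 \<boxtimes> A1 \<boxplus> D2 \<boxtimes> A2) (C2 \<boxtimes> B1 \<boxplus> D2 \<boxtimes> B2) u1 u2,
        cf + (cg + (c1 + (x1 + x2 + c2 + (x3 + (x4 + (x5 + x6)))))))"
      using pos cf(2) cg(2) e1 e2 x1(2) x2(2) x3(2) x4(2) x5(2) x6(2)
      by (subst app_rfr_prog) (simp add: basis_code_def ev_simps basis_val_def call_shift hn(1,2))
    have "TM n \<le> n * \<mu>" using less.prems by simp
    \<comment> \<open>The two truncations cost at most \<open>2 * n\<close>, the six calls of
      function 7 at most \<open>12 * TM n + 24 * n + 12\<close>. As \<open>n\<close> is positive, 38
      = 26 + 12 absorbs the linear and the constant term.\<close>
    then have "cf + (cg + (c1 + (x1 + x2 + c2 + (x3 + (x4 + (x5 + x6)))))) \<le>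
        c1 + c2 + 12 * (n * \<mu>) + 26 * n + 12"
      using cf(1) cg(1) x1(1) x2(1) x3(1) x4(1) x5(1) x6(1) unfolding b_def by linarith
    also have "\<dots> \<le> c1 + c2 + 38 * n * (\<mu> + 1)" using h by (simp add: algebra_simps)
    also have "\<dots> \<le> 38 * (h * (depth h + 1) + (n - h) * (depth (n - h) + 1) + n) * (\<mu> + 1)"
      using c1 c2 by (simp only: add_mult_distrib add_mult_distrib2)
    also have "\<dots> \<le> 38 * (n * (depth n + 1)) * (\<mu> + 1)"
      by (rule mult_right_mono[OF mult_left_mono[OF depth_recurrence]]) (use pos h_def in auto)
    finally show ?thesis using ob code by blast
  qed
qed

text \<open>The full tie is the dearest case: two subtractions for \<open>e1\<close> and
  \<open>e2\<close>, two zero tests, two operations for the negated quotient, and two calls of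
  function 7.\<close>

lemma call_row:
  assumes Q: "order_basis l 0 m f g A1 B1 A2 B2 d1 d2"
  shows "\<exists>Y Z. \<exists>c \<le> 2 * (2 * TM l + 4 * l + 2) + 6. minimal_row m A1 B1 A2 B2 d1 d2 = (Y, Z) \<and>
    call 13 (VPair (VInt p) (VPair (VInt m) (basis_val A1 B1 A2 B2 d1 d2))) = Some (VPair
        (poly_val Y) (poly_val Z), c)"
proof -
  define e1 e2 where "e1 = coeff A1 (nat d1) \<ominus> coeff B1 (nat (d1 - m))"
    and "e2 = coeff A2 (nat d1) \<ominus> coeff B2 (nat (d1 - m))"
  have cl: "A1 \<in> carrier P" "B1 \<in> carrier P" "A2 \<in> carrier P" "B2 \<in> carrier P"
    and d: "deg_le A1 (int l)" "deg_le B1 (int l)" "deg_le A2 (int l)" "deg_le B2 (int l)"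
    using Q by (simp_all add: order_basis_def)
  have e: "e1 \<in> carrier R" "e2 \<in> carrier R" using cl by (simp_all add: e1_def e2_def)
  have row: "minimal_row m A1 B1 A2 B2 d1 d2 = (if d1 < d2 then (A1, B1) else if d2 < d1 then (A2,
      B2)
      else if e1 = \<zero> then (A1, B1) else if e2 = \<zero> then (A2, B2)
      else ([\<ominus> (e2 \<otimes> inv e1)] \<boxtimes> A1 \<boxplus> A2, [\<ominus> (e2 \<otimes> inv e1)] \<boxtimes> B1 \<boxplus> B2))"
    by (simp add: minimal_row_def Let_def e1_def e2_def)
  note [simp] = row_code_def Let_def ev_simps int_consts basis_val_def call_shift call_coeff0
      coeff_shift
    e1_def[symmetric] e2_def[symmetric]
  consider "d1 < d2" | "d2 < d1" | "d2 = d1" "e1 = \<zero>" | "d2 = d1" "e1 \<noteq> \<zero>" "e2 = \<zero>"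
    | "d2 = d1" "e1 \<noteq> \<zero>" "e2 \<noteq> \<zero>" by linarith
  then show ?thesis
  proof cases
    case 1
    then show ?thesis unfolding row by (subst app_rfr_prog) simp
  next
    case 2
    then show ?thesis unfolding row by (subst app_rfr_prog) simp
  next
    case 3
    then show ?thesis unfolding row by (subst app_rfr_prog) simp
  next
    case 4
    then show ?thesis unfolding row by (subst app_rfr_prog) simp
  next
    case 5
    define q where "q = \<ominus> (e2 \<otimes> inv e1)"
    have q: "q \<in> carrier R - {\<zero>}" using minus_div_nonzero[of e2 e1] 5 e by (simp add: q_def)
    have q': "\<zero> \<ominus> e2 \<otimes> inv e1 = q" using 5 e by (simp add: minus_eq q_def field_Units)
    obtain x where x: "x \<le> 2 * TM l + 4 * l + 2"
      "call 7 (VPair (VInt p) (VPair (poly_val [q]) (VPair (poly_val A1) (VPair (poly_val [\<one>])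
          (poly_val A2)))))
       = Some (poly_val ([q] \<boxtimes> A1 \<boxplus> A2), x)"
      using call_dot[of "[q]" A1 "[\<one>]" A2 l] q cl d by (auto simp: deg_le_const)
    obtain y where y: "y \<le> 2 * TM l + 4 * l + 2"
      "call 7 (VPair (VInt p) (VPair (poly_val [q]) (VPair (poly_val B1) (VPair (poly_val [\<one>])
          (poly_val B2)))))
       = Some (poly_val ([q] \<boxtimes> B1 \<boxplus> B2), y)"
      using call_dot[of "[q]" B1 "[\<one>]" B2 l] q cl d by (auto simp: deg_le_const)
    show ?thesis using 5 x y unfolding row
      by (subst app_rfr_prog) (simp add: q' q_def[symmetric])
  qed
qed

lemma call_monic:
  assumes Y: "Y \<in> carrier P" "Y \<noteq> []" and h: "hd Y \<in> carrier R - {\<zero>}" and d: "deg_le Y (int l)"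
  shows "\<exists>c \<le> TM l + 1. call 14 (VPair (VInt p) (poly_val Y)) = Some (poly_val ([inv (hd Y)] \<boxtimes> Y),
      c)"
proof -
  obtain y ys where ys: "Y = y # ys" using Y by (cases Y) auto
  have i: "inv y \<in> carrier R - {\<zero>}" using nonzero_div[of \<one> y] h by (simp add: ys field_Units)
  obtain c where "c \<le> TM l"
    "call 15 (VPair (VInt p) (VPair (poly_val [inv y]) (poly_val Y))) = Some (poly_val ([inv y] \<boxtimes>
        Y), c)"
    using call_mult[of "[inv y]" Y l] i Y(1) d by (auto simp: deg_le_const)
  then show ?thesis using i h
    by (subst app_rfr_prog) (simp add: monic_code_def ev_simps int_consts ys)
qed

theorem run_rfr_prog:
  assumes F: "monic_poly R F" and G: "monic_poly R G" and coprime: "\<one>\<^bsub>P\<^esub> gcdof\<^bsub>P\<^esub> F G"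
    and G0: "eval G \<zero> \<noteq> \<zero>" and l: "0 < l" and deg: "degree F + degree G \<le> l"
    and m: "int (degree F) - int (degree G) = m"
    and S: "S \<in> carrier P" "frac_mod R F G l = S"
    and TM: "\<And>k. 0 < k \<Longrightarrow> k \<le> l \<Longrightarrow> TM k \<le> k * \<mu>"
  shows "\<exists>c \<le> 58 * (l * (depth l + 1)) * (\<mu> + 1).
    run R code (VPair (VInt p) (VPair (VInt (int l)) (VPair (VInt m) (poly_val S))))
      (VPair (poly_val F) (poly_val G)) c"
proof -
  have m1: "[\<ominus> \<one>] \<in> carrier P" using minus_div_nonzero[of \<one> \<one>] by simp
  obtain A1 B1 A2 B2 d1 d2 c1 where c1: "c1 \<le> 38 * (l * (depth l + 1)) * (\<mu> + 1)"
    and Q: "order_basis l 0 m [\<ominus> \<one>] S A1 B1 A2 B2 d1 d2"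
    and e1: "call 12 (VPair (VInt p) (VPair (VInt (int l)) (VPair (VInt 0) (VPair (VInt m)
      (VPair (poly_val [\<ominus> \<one>]) (poly_val S)))))) = Some (basis_val A1 B1 A2 B2 d1 d2, c1)"
    using call_basis[OF l m1 S(1) TM, of 0 m] by blast
  obtain Y Z c2 where c2: "c2 \<le> 2 * (2 * TM l + 4 * l + 2) + 6"
    and row: "minimal_row m A1 B1 A2 B2 d1 d2 = (Y, Z)"
    and e2: "call 13 (VPair (VInt p) (VPair (VInt m) (basis_val A1 B1 A2 B2 d1 d2))) =
      Some (VPair (poly_val Y) (poly_val Z), c2)"
    using call_row[OF Q] by blast
  note rec = reconstruction[OF F G coprime G0 l deg m S Q row]
  have YZ: "Y \<in> carrier P" "Z \<in> carrier P"
    using minimal_row_closed[OF _ _ _ _ row] Q by (simp_all add: order_basis_def)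
  have len: "length F = length Y" "length G = length Z"
    using rec(5,6) poly_mult_const(1)[OF carrier_is_subring, of Y "inv (hd Y)"]
      poly_mult_const(1)[OF carrier_is_subring, of Z "inv (hd Z)"] nonzero_div[of \<one> "hd Y"]
          nonzero_div[of \<one> "hd Z"]
      rec(3,4) YZ by (auto simp: multP carrierP_iff field_Units)
  have "deg_le Y (int l)" "deg_le Z (int l)"
    using deg len unfolding deg_le_length[OF YZ(1)] deg_le_length[OF YZ(2)] by linarith+
  then obtain c3 c4 where c3: "c3 \<le> TM l + 1" "call 14 (VPair (VInt p) (poly_val Y)) = Some
      (poly_val F, c3)"
    and c4: "c4 \<le> TM l + 1" "call 14 (VPair (VInt p) (poly_val Z)) = Some (poly_val G, c4)"
    using call_monic[OF YZ(1) rec(1,3)] call_monic[OF YZ(2) rec(2,4)] rec(5,6) by metis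
  have "call 0 (VPair (VInt p) (VPair (VInt (int l)) (VPair (VInt m) (poly_val S)))) =
      Some (VPair (poly_val F) (poly_val G), c1 + c2 + (c3 + c4))"
    using e1 e2 c3(2) c4(2) by (subst app_rfr_prog) (simp add: main_code_def ev_simps int_consts)
  then have "run R code (VPair (VInt p) (VPair (VInt (int l)) (VPair (VInt m) (poly_val S))))
      (VPair (poly_val F) (poly_val G)) (c1 + c2 + (c3 + c4))"
    by (simp add: run_def ev_eq_Some_iff[symmetric] ev_simps)
  moreover have "c1 + c2 + (c3 + c4) \<le> 58 * (l * (depth l + 1)) * (\<mu> + 1)"
  proof -
    \<comment> \<open>The row selection costs at most \<open>4 * TM l + 8 * l + 10\<close> and the
      two normalisations \<open>2 * TM l + 2\<close>. Again 20 = 8 + 12 absorbs this, and 58 = 38 +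
      20.\<close>
    have "c1 + c2 + (c3 + c4) \<le> c1 + 6 * (l * \<mu>) + 8 * l + 12" using c2 c3(1) c4(1) TM[of l] l by
        simp
    also have "\<dots> \<le> c1 + 20 * (l * 1) * (\<mu> + 1)" using l by (simp add: algebra_simps)
    also have "\<dots> \<le> c1 + 20 * (l * (depth l + 1)) * (\<mu> + 1)"
      by (intro add_left_mono mult_right_mono mult_left_mono) simp_all
    also have "\<dots> \<le> 58 * (l * (depth l + 1)) * (\<mu> + 1)"
    proof -
      have "c1 + 20 * a * b \<le> 58 * a * b" if "c1 \<le> 38 * a * b" for a b using that by simp
      then show ?thesis using c1 .
    qed
    finally show ?thesis .
  qed
  ultimately show ?thesis by blast
qed

end

section \<open>Asymptotics\<close>

text \<open>The added one makes up for rounding down in \<open>div\<close>. Taking the maximum over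
  all sizes up to \<open>l\<close> covers every recursive call at once.\<close>

definition mult_rate :: "(nat \<Rightarrow> nat) \<Rightarrow> nat \<Rightarrow> nat" where
  "mult_rate TM l = Max ((\<lambda>k. TM k div k + 1) ` {1..l})"

lemma mult_rate: "0 < k \<Longrightarrow> k \<le> l \<Longrightarrow> TM k \<le> k * mult_rate TM l"
proof -
  assume k: "0 < k" "k \<le> l"
  then have "TM k div k + 1 \<le> mult_rate TM l" unfolding mult_rate_def by (intro Max_ge) auto
  then have "k * (TM k div k + 1) \<le> k * mult_rate TM l" by (rule mult_le_mono2)
  moreover have "TM k < k * (TM k div k + 1)" using k dividend_less_times_div[of k "TM k"] by simp
  ultimately show "TM k \<le> k * mult_rate TM l" by linarith
qed

text \<open>The assumed bound holds only from some \<open>N\<close> on. Smaller sizes contribute at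
  most the constant \<open>B\<close>, and constants are absorbed by the logarithm, which is at least
  1 from 3 on.\<close>

lemma mult_rate_bigo:
  assumes "(\<lambda>n. real (TM n)) \<in> O(\<lambda>n. real n * ln (real n))"
  shows "(\<lambda>l. real (mult_rate TM l + 1)) \<in> O(\<lambda>l. ln (real l))"
proof -
  obtain c where c: "c > 0" "\<forall>\<^sub>F n in sequentially. norm (real (TM n)) \<le> c * norm (real n * ln
      (real n))"
    using landau_o.bigE[OF assms] by blast
  then obtain N where N: "\<And>n. n \<ge> N \<Longrightarrow> real (TM n) \<le> c * \<bar>real n * ln (real n)\<bar>"
    by (auto simp: eventually_sequentially)
  define B where "B = (\<Sum>k<N. real (TM k))"
  have rate: "real (TM k div k) \<le> B + c * ln (real l)" if "1 \<le> k" "k \<le> l" for k l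
  proof (cases "k < N")
    case True
    have "real (TM k div k) \<le> real (TM k)" by simp
    also have "\<dots> \<le> B" unfolding B_def using True by (intro member_le_sum) auto
    finally show ?thesis using c(1) that by (simp add: add_increasing2)
  next
    case False
    have "real (TM k div k) \<le> real (TM k) / real k" by (rule of_nat_div_le_of_nat)
    also have "\<dots> \<le> c * ln (real k)" using N[of k] False that by (simp add: field_simps abs_mult)
    also have "\<dots> \<le> c * ln (real l)" using that c(1) by simp
    finally show ?thesis unfolding B_def by (simp add: add_increasing sum_nonneg)
  qed
  have bound: "real (mult_rate TM l + 1) \<le> (B + c + 2) * ln (real l)" if l: "3 \<le> l" for l
  proof -
    have "mult_rate TM l \<in> (\<lambda>k. TM k div k + 1) ` {1..l}"
      unfolding mult_rate_def using l by (intro Max_in) auto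
    then have *: "real (mult_rate TM l + 1) \<le> B + c * ln (real l) + 2" using rate by fastforce
    have "exp 1 \<le> real l" using l exp_le by linarith
    then have "1 \<le> ln (real l)" using l by (simp add: ln_ge_iff)
    moreover have "0 \<le> B" unfolding B_def by (simp add: sum_nonneg)
    ultimately have "B + 2 \<le> (B + 2) * ln (real l)" by (simp add: mult_le_cancel_left1)
    with * show ?thesis by (simp add: algebra_simps)
  qed
  show ?thesis
  proof (rule bigoI)
    show "\<forall>\<^sub>F l in sequentially. norm (real (mult_rate TM l + 1)) \<le> (B + c + 2) * norm (ln (real
        l))"
      using eventually_ge_at_top[of "3::nat"]
    proof eventually_elim
      case (elim l)
      then show ?case using bound[of l] by simp
    qed
  qed
qed

lemma depth_bigo: "(\<lambda>l. real (depth l + 1)) \<in> O(\<lambda>l. ln (real l))"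
proof (rule bigoI)
  show "\<forall>\<^sub>F l in sequentially. norm (real (depth l + 1)) \<le> (1 / ln 2 + 2) * norm (ln (real l))"
    using eventually_ge_at_top[of "3::nat"]
  proof eventually_elim
    case (elim l)
    have "2 ^ depth l \<le> 2 * l" using two_power_depth[of l] elim by linarith
    then have "2 ^ depth l \<le> 2 * real l" by (metis of_nat_le_iff of_nat_mult of_nat_numeral
        of_nat_power)
    then have "ln (2 ^ depth l) \<le> ln (2 * real l)" using elim by (subst ln_le_cancel_iff) auto
    then have "real (depth l) * ln 2 \<le> ln 2 + ln (real l)" using elim by (simp add: ln_realpow
        ln_mult)
    then have "real (depth l) \<le> 1 + ln (real l) / ln 2" by (simp add: field_simps)
    moreover have "1 \<le> ln (real l)"
    proof -
      have "exp 1 \<le> real l" using elim exp_le by linarith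
      then show ?thesis using elim by (simp add: ln_ge_iff)
    qed
    ultimately show ?case by (simp add: algebra_simps)
  qed
qed

lemma prime_field_polynomials:
  assumes "Factorial_Ring.prime p"
  shows "field_polynomials (prime_field p)"
proof -
  interpret residues_prime p "prime_field p" by unfold_locales (use assms in auto)
  show ?thesis by (rule field_polynomials.intro) (rule is_field)
qed

theorem theorem4:
  shows
    "(\<forall>(p::nat) (l::nat) (R::int list) (m::int).
        rfr_instance p l R m \<longrightarrow> (\<exists>F G. rfr_solution p l R m F G) \<longrightarrow>
        (\<exists>!FG. rfr_solution p l R m (fst FG) (snd FG))) \<and>
     (\<forall>(M::prog) (TM::nat \<Rightarrow> nat).
        (\<lambda>n. real (TM n)) \<in> O(\<lambda>n. real n * ln (real n)) \<longrightarrow>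
        (\<exists>(D::prog) (T::nat \<Rightarrow> nat).
           (\<lambda>l. real (T l)) \<in> O(\<lambda>l. real l * (ln (real l))\<^sup>2) \<and>
           (\<forall>p::nat. Factorial_Ring.prime p \<longrightarrow> multiplies_within p M TM \<longrightarrow> reconstructs_within p D
               T)))"
proof (intro conjI allI impI)
  fix p l :: nat and S :: "int list" and m :: int
  assume inst: "rfr_instance p l S m" and ex: "\<exists>F G. rfr_solution p l S m F G"
  then interpret field_polynomials "prime_field p" "poly_ring (prime_field p)"
    by (simp_all add: prime_field_polynomials rfr_instance_def)
  have l: "0 < l" and S: "S \<in> carrier (poly_ring (prime_field p))" using inst by (auto simp:
      rfr_instance_def)
  have m1: "[\<ominus>\<^bsub>prime_field p\<^esub> \<one>\<^bsub>prime_field p\<^esub>] \<in> carrier (poly_ring (prime_field p))"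
    using minus_div_nonzero[of "\<one>\<^bsub>prime_field p\<^esub>" "\<one>\<^bsub>prime_field p\<^esub>"] by simp
  obtain A1 B1 A2 B2 d1 d2 where Q: "order_basis l 0 m [\<ominus>\<^bsub>prime_field p\<^esub> \<one>\<^bsub>prime_field p\<^esub>] S A1 B1
      A2 B2 d1 d2"
    using order_basis_exists[OF m1 S l] by blast
  obtain Y Z where row: "minimal_row m A1 B1 A2 B2 d1 d2 = (Y, Z)" by fastforce
  \<comment> \<open>Both solutions are given by the same formula in the fixed row
    \<open>(Y, Z)\<close>.\<close>
  have "F = F' \<and> G = G'" if "rfr_solution p l S m F G" "rfr_solution p l S m F' G'" for F G F' G'
    using reconstruction(5,6)[OF _ _ _ _ l _ _ S _ Q row] that
    unfolding rfr_solution_def Let_def by metis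
  then show "\<exists>!FG. rfr_solution p l S m (fst FG) (snd FG)"
    using ex by (metis fst_conv snd_conv prod.collapse)
next
  fix M :: prog and TM :: "nat \<Rightarrow> nat"
  assume TM: "(\<lambda>n. real (TM n)) \<in> O(\<lambda>n. real n * ln (real n))"
  \<comment> \<open>The program and its bound have to be chosen before \<open>p\<close>; accordingly
    \<open>T\<close> is built from \<open>TM\<close> alone.\<close>
  define T where "T l = 58 * (l * (depth l + 1)) * (mult_rate TM l + 1)" for l
  have "(\<lambda>l. 58 * (real l * real (depth l + 1)) * real (mult_rate TM l + 1))
      \<in> O(\<lambda>l. real l * ln (real l) * ln (real l))"
    by (intro landau_o.big.mult mult_rate_bigo[OF TM] depth_bigo landau_o.big.cmult_in_iff[THEN
        iffD2])
      simp_all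
  moreover have "real (T l) = 58 * (real l * real (depth l + 1)) * real (mult_rate TM l + 1)" for l
    by (simp only: T_def of_nat_mult of_nat_numeral)
  ultimately have "(\<lambda>l. real (T l)) \<in> O(\<lambda>l. real l * (ln (real l))\<^sup>2)"
    by (simp only: power2_eq_square mult.assoc)
  moreover have "reconstructs_within p (rfr_prog M) T"
    if p: "Factorial_Ring.prime p" and mult: "multiplies_within p M TM" for p
  proof -
    interpret field_polynomials "prime_field p" "poly_ring (prime_field p)"
      by (simp_all add: prime_field_polynomials p)
    interpret rfr_machine "prime_field p" "poly_ring (prime_field p)" M TM "int p"
      by unfold_locales (use mult in \<open>auto simp: multiplies_within_def Let_def\<close>)
    show ?thesis
      unfolding reconstructs_within_def rfr_instance_def rfr_solution_def Let_def T_def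
      by (intro allI impI, elim conjE, rule run_rfr_prog) (auto intro: mult_rate)
  qed
  ultimately show "\<exists>D T. (\<lambda>l. real (T l)) \<in> O(\<lambda>l. real l * (ln (real l))\<^sup>2) \<and>
      (\<forall>p::nat. Factorial_Ring.prime p \<longrightarrow> multiplies_within p M TM \<longrightarrow> reconstructs_within p D T)"
    by blast
qed

end
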